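(* Let $B$ be a Martin-Löf random path and $Z_B=\{t\geq 0: B(t)=0\}$. Then $Z_B$ is a non-empty closed set which is recursive layerwise in $B$; that is, there is a partial computable procedure which, given rationals $a<b$, an integer $n$, and $B$ as oracle, correctly decides whether $Z_B\cap(a,b)=\emptyset$ whenever $B\in\mathcal{K}_n$.
   Context: Paths are elements of $C[0,\infty)$ (continuous real functions on $[0,\infty)$), equipped with Wiener measure (law of standard one-dimensional Brownian motion started at $0$), which is a computable probability space; $C[0,\infty)$ is identified with countably many copies of $C[0,1]$ with the product measure via $B(t)=B_{\lfloor t\rfloor}(t-\lfloor t\rfloor)+\sum_{i<\lfloor t\rfloor}B_i(1)$. A path is Martin-Löf random if it is Martin-Löf random for Wiener measure. If $(\mathcal{U}_n)$ is a universal Martin-Löf test on this space, $\mathcal{K}_n$ denotes the complement of $\mathcal{U}_n$ (the $n$-th "layer"); a closed set $\mathcal{C}\subseteq\mathbb{R}$ is recursive if the predicate $\mathcal{C}\cap(a,b)=\emptyset$ on pairs of rationals $a<b$ is decidable. *)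

theory Defs
  imports "HOL-Probability.Probability" "HOL-Library.Nat_Bijection" "HOL-Library.Countable"
begin

section \<open>Partial computable functions with an oracle\<close>

text \<open>
  Partial recursive functions relative to an oracle \<open>\<phi> :: nat \<Rightarrow> nat\<close>: \<open>computes \<phi> p xs y\<close> means that
  program \<open>p\<close> with oracle \<open>\<phi>\<close> halts on the arguments \<open>xs\<close> with output \<open>y\<close>.
\<close>

datatype prog =
    Zero
  | Succ
  | Proj nat
  | Query
  | Comp prog "prog list"
  | PRec prog prog
  | Mu prog

inductive computes :: "(nat \<Rightarrow> nat) \<Rightarrow> prog \<Rightarrow> nat list \<Rightarrow> nat \<Rightarrow> bool"
  for \<phi> :: "nat \<Rightarrow> nat" where
  zero: "computes \<phi> Zero xs 0"
| succ: "computes \<phi> Succ (x # xs) (Suc x)"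
| proj: "i < length xs \<Longrightarrow> computes \<phi> (Proj i) xs (xs ! i)"
| query: "computes \<phi> Query (x # xs) (\<phi> x)"
| comp: "list_all2 (\<lambda>g y. computes \<phi> g xs y) gs ys \<Longrightarrow> computes \<phi> f ys z
    \<Longrightarrow> computes \<phi> (Comp f gs) xs z"
| prec_0: "computes \<phi> f xs y \<Longrightarrow> computes \<phi> (PRec f g) (0 # xs) y"
| prec_Suc: "computes \<phi> (PRec f g) (n # xs) y \<Longrightarrow> computes \<phi> g (n # y # xs) z
    \<Longrightarrow> computes \<phi> (PRec f g) (Suc n # xs) z"
| mu: "computes \<phi> f (n # xs) 0 \<Longrightarrow> (\<And>m. m < n \<Longrightarrow> \<exists>y. computes \<phi> f (m # xs) (Suc y))
    \<Longrightarrow> computes \<phi> (Mu f) xs n"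

inductive_cases computes_ZeroE: "computes \<phi> Zero xs z"
inductive_cases computes_SuccE: "computes \<phi> Succ xs z"
inductive_cases computes_ProjE: "computes \<phi> (Proj i) xs z"
inductive_cases computes_QueryE: "computes \<phi> Query xs z"
inductive_cases computes_CompE: "computes \<phi> (Comp f gs) xs z"
inductive_cases computes_PRec0E: "computes \<phi> (PRec f g) (0 # xs) z"
inductive_cases computes_PRecSucE: "computes \<phi> (PRec f g) (Suc n # xs) z"
inductive_cases computes_MuE: "computes \<phi> (Mu f) xs z"

lemma computes_deterministic:
  "computes \<phi> p xs y \<Longrightarrow> computes \<phi> p xs z \<Longrightarrow> y = z"
proof (induction arbitrary: z rule: computes.induct)
  case (zero xs)
  then show ?case by (rule computes_ZeroE) simp
next
  case (succ x xs)
  then show ?case by (rule computes_SuccE) simp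
next
  case (proj i xs)
  from proj.prems show ?case by (rule computes_ProjE) simp
next
  case (query x xs)
  then show ?case by (rule computes_QueryE) simp
next
  case (comp xs gs ys f w)
  from comp.prems obtain ys' where
    ys': "list_all2 (\<lambda>g y. computes \<phi> g xs y) gs ys'" and f: "computes \<phi> f ys' z"
    by (rule computes_CompE)
  have "ys = ys'"
  proof (rule nth_equalityI)
    show "length ys = length ys'"
      using list_all2_lengthD[OF comp.IH(1)] list_all2_lengthD[OF ys'] by simp
  next
    fix i assume i: "i < length ys"
    then have "i < length gs" using list_all2_lengthD[OF comp.IH(1)] by simp
    then show "ys ! i = ys' ! i"
      using list_all2_nthD[OF comp.IH(1)] list_all2_nthD[OF ys'] by simp
  qed
  with comp.IH(2) f show ?case by blast
next
  case (prec_0 f xs y g)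
  from prec_0.prems show ?case by (rule computes_PRec0E) (rule prec_0.IH)
next
  case (prec_Suc f g n xs y w)
  from prec_Suc.prems obtain y' where
    "computes \<phi> (PRec f g) (n # xs) y'" "computes \<phi> g (n # y' # xs) z"
    by (rule computes_PRecSucE)
  with prec_Suc.IH show ?case by blast
next
  case (mu f n xs)
  from mu.prems have 0: "computes \<phi> f (z # xs) 0"
    and S: "\<And>m. m < z \<Longrightarrow> \<exists>y. computes \<phi> f (m # xs) (Suc y)"
    by (rule computes_MuE, blast)+
  have "\<not> z < n" using mu.IH(2) 0 by blast
  moreover have "\<not> n < z" using mu.IH(1) S by blast
  ultimately show ?case by simp
qed

text \<open>Computability without an oracle is computability with a constant oracle.\<close>

definition ce_rel :: "(nat \<Rightarrow> nat \<Rightarrow> bool) \<Rightarrow> bool" where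
  "ce_rel R \<longleftrightarrow> (\<exists>p. \<forall>n k. R n k \<longleftrightarrow> (\<exists>y. computes (\<lambda>_. 0) p [n, k] y))"

definition rat_code :: "nat \<Rightarrow> real" where
  "rat_code c = of_rat (nat_to_rat_surj c)"


section \<open>Path space and Wiener measure\<close>

text \<open>
  Elements of \<open>C[0,\<infinity>)\<close> are extensional functions on \<open>{0..}\<close>. The \<open>\<sigma>\<close>-algebra is generated by the
  evaluations; it is the Borel \<open>\<sigma>\<close>-algebra of locally uniform convergence.
\<close>

definition path_space :: "(real \<Rightarrow> real) measure" where
  "path_space = restrict_space (\<Pi>\<^sub>M t\<in>{0..}. borel) {B. continuous_on {0..} B}"

abbreviation paths :: "(real \<Rightarrow> real) set" where
  "paths \<equiv> space path_space"

lemma paths_eq: "paths = {B \<in> extensional {0..}. continuous_on {0..} B}"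
  by (auto simp: path_space_def space_restrict_space space_PiM PiE_def)

text \<open>These conditions determine \<open>W\<close> uniquely.\<close>

definition wiener_measure :: "(real \<Rightarrow> real) measure \<Rightarrow> bool" where
  "wiener_measure W \<longleftrightarrow>
     prob_space W \<and> sets W = sets path_space \<and>
     (AE B in W. B 0 = 0) \<and>
     (\<forall>s t. 0 \<le> s \<longrightarrow> s < t \<longrightarrow>
        distributed W lborel (\<lambda>B. B t - B s) (normal_density 0 (sqrt (t - s)))) \<and>
     (\<forall>(n::nat) (\<tau>::nat \<Rightarrow> real). 0 \<le> \<tau> 0 \<longrightarrow> strict_mono \<tau> \<longrightarrow>
        prob_space.indep_vars W (\<lambda>_. borel) (\<lambda>i B. B (\<tau> (Suc i)) - B (\<tau> i)) {..<n})"


section \<open>The computable structure of path space\<close>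

text \<open>
  \<open>piece B i\<close>, as a function on \<open>{0..1}\<close>, is the component \<open>B\<^sub>i\<close> of the identification of \<open>B\<close> with a
  sequence in \<open>C[0,1]\<close>; compare \<open>path_eq_pieces\<close>. The first piece is \<open>B\<close> itself and keeps \<open>B 0\<close>.
\<close>

definition piece :: "(real \<Rightarrow> real) \<Rightarrow> nat \<Rightarrow> real \<Rightarrow> real" where
  "piece B i t = (if i = 0 then B t else B (real i + t) - B (real i))"

lemma path_eq_pieces:
  assumes "0 \<le> t"
  shows "B t = piece B (nat \<lfloor>t\<rfloor>) (t - \<lfloor>t\<rfloor>) + (\<Sum>i<nat \<lfloor>t\<rfloor>. piece B i 1)"
proof -
  have sum: "(\<Sum>i<n. piece B i 1) = (if n = 0 then 0 else B (real n))" for n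
    by (induction n) (auto simp: piece_def add.commute)
  show ?thesis
  proof (cases "nat \<lfloor>t\<rfloor> = 0")
    case True
    then have "\<lfloor>t\<rfloor> = 0" using assms by linarith
    with True show ?thesis by (simp add: piece_def)
  next
    case False
    moreover from this have "real (nat \<lfloor>t\<rfloor>) = real_of_int \<lfloor>t\<rfloor>" by simp
    ultimately have "piece B (nat \<lfloor>t\<rfloor>) (t - \<lfloor>t\<rfloor>) = B t - B \<lfloor>t\<rfloor>"
      and "(\<Sum>i<nat \<lfloor>t\<rfloor>. piece B i 1) = B \<lfloor>t\<rfloor>"
      by (simp_all only: sum) (simp_all add: piece_def)
    then show ?thesis by simp
  qed
qed

definition uniform_dist :: "(real \<Rightarrow> real) \<Rightarrow> (real \<Rightarrow> real) \<Rightarrow> real" where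
  "uniform_dist f g = (SUP t\<in>{0..1}. \<bar>f t - g t\<bar>)"

text \<open>
  The ideal points of \<open>C[0,1]\<close> are the piecewise linear functions with rational breakpoints and
  values. Over a common denominator of the breakpoints, such a function is given by its values
  \<open>q\<^sub>0, \<dots>, q\<^sub>m\<close> at \<open>0, 1/m, \<dots>, 1\<close>, and it is a combination of hat functions.
\<close>

definition polygon :: "real list \<Rightarrow> real \<Rightarrow> real" where
  "polygon qs t = (\<Sum>j<length qs. qs ! j * max 0 (1 - \<bar>real (length qs - 1) * t - real j\<bar>))"

definition polygon_code :: "nat \<Rightarrow> real \<Rightarrow> real" where
  "polygon_code c = polygon (map rat_code (list_decode c))"

text \<open>
  Basic open sets of the product topology: finitely many components are constrained to balls
  around ideal points. A number codes the list of pairs (centre, rational radius).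
\<close>

definition basic_open :: "nat \<Rightarrow> (real \<Rightarrow> real) set" where
  "basic_open k = {B \<in> paths. \<forall>i<length (list_decode k).
     (case prod_decode (list_decode k ! i) of (c, r) \<Rightarrow>
        uniform_dist (piece B i) (polygon_code c) < rat_code r)}"

text \<open>
  A path is presented as an oracle by a fast converging sequence of ideal points for each component.
\<close>

definition path_name :: "(nat \<Rightarrow> nat) \<Rightarrow> (real \<Rightarrow> real) \<Rightarrow> bool" where
  "path_name \<phi> B \<longleftrightarrow>
     (\<forall>i k. uniform_dist (piece B i) (polygon_code (\<phi> (prod_encode (i, k)))) \<le> (1/2) ^ k)"


section \<open>Martin-Loef randomness and layerwise recursiveness\<close>

definition effectively_open :: "(nat \<Rightarrow> (real \<Rightarrow> real) set) \<Rightarrow> bool" where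
  "effectively_open U \<longleftrightarrow> (\<exists>R. ce_rel R \<and> (\<forall>n. U n = (\<Union>k\<in>{k. R n k}. basic_open k)))"

definition martin_loef_test :: "(real \<Rightarrow> real) measure \<Rightarrow> (nat \<Rightarrow> (real \<Rightarrow> real) set) \<Rightarrow> bool" where
  "martin_loef_test W U \<longleftrightarrow> effectively_open U \<and> (\<forall>n. measure W (U n) \<le> (1/2) ^ n)"

definition martin_loef_random :: "(real \<Rightarrow> real) measure \<Rightarrow> (real \<Rightarrow> real) \<Rightarrow> bool" where
  "martin_loef_random W B \<longleftrightarrow> B \<in> paths \<and> (\<forall>U. martin_loef_test W U \<longrightarrow> B \<notin> (\<Inter>n. U n))"

definition universal_martin_loef_test ::
    "(real \<Rightarrow> real) measure \<Rightarrow> (nat \<Rightarrow> (real \<Rightarrow> real) set) \<Rightarrow> bool" where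
  "universal_martin_loef_test W U \<longleftrightarrow> martin_loef_test W U \<and> (\<forall>V. martin_loef_test W V \<longrightarrow> (\<Inter>n. V n) \<subseteq> (\<Inter>n. U n))"

definition layer :: "(nat \<Rightarrow> (real \<Rightarrow> real) set) \<Rightarrow> nat \<Rightarrow> (real \<Rightarrow> real) set" where
  "layer U n = paths - U n"

text \<open>
  One program serves all paths and all layers. It must give the correct answer for every name of
  \<open>B\<close> as oracle; nothing is required when \<open>B\<close> is outside the layer.
\<close>

definition recursive_layerwise ::
    "(nat \<Rightarrow> (real \<Rightarrow> real) set) \<Rightarrow> ((real \<Rightarrow> real) \<Rightarrow> real set) \<Rightarrow> bool" where
  "recursive_layerwise U C \<longleftrightarrow>
     (\<exists>p. \<forall>n. \<forall>B \<in> layer U n. \<forall>\<phi>. path_name \<phi> B \<longrightarrow>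
        (\<forall>a b. rat_code a < rat_code b \<longrightarrow>
           computes \<phi> p [a, b, n] (if C B \<inter> {rat_code a<..<rat_code b} = {} then 1 else 0)))"

definition zero_set :: "(real \<Rightarrow> real) \<Rightarrow> real set" where
  "zero_set B = {t. 0 \<le> t \<and> B t = 0}"

end

theory Submission
  imports Defs
begin

text \<open>
  A random path satisfies \<open>B 0 = 0\<close>, and on an interval \<open>[a, b]\<close> with rational ends \<open>0 \<le> a < b\<close> its minimum
  and its maximum are not \<open>0\<close>. Hence, if it has a zero in \<open>[a, b]\<close>, it changes sign in \<open>(a, b)\<close>. Both a
  sign change in \<open>(a, b)\<close> and the absence of zeros in \<open>[a, b]\<close> are confirmed by finitely many rational
  inequalities about a sufficiently precise polygonal approximation, so a search for either
  certificate terminates on every random path. The layer is only used to conclude that the path is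
  random: a path outside \<open>U n\<close> is outside the intersection of every test.

  The paths with minimum \<open>0\<close> on \<open>[a, b]\<close> form an effectively null set, because the events
  \<open>\<bar>min B\<bar> < \<epsilon>\<close> are effectively open and have small probability. For \<open>a > 0\<close> the minimum over a grid is
  the sum of \<open>B a\<close>, which has bounded density, and an independent variable. For \<open>a = 0\<close>, on a fast
  geometric sequence of times the increments dominate the values reached before them and are
  independent, so \<open>B\<close> is unlikely to stay above \<open>- \<epsilon>\<close> at all of these times.
\<close>

section \<open>Computable functions\<close>

text \<open>A sign change is sought in the open interval, absence of zeros on the closed one. An
  open condition is confirmed at sampled points, while absence has to be confirmed on a compact set,
  where continuity provides a positive margin. The gap between the two is a path with a zero in
  \<open>[a, b]\<close>, possibly at an end, that keeps one sign on \<open>(a, b)\<close>; then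
  \<open>\<sigma> * B\<close> has minimum exactly 0 there for \<open>\<sigma>\<close> equal to 1 or
  -1. Both certificates are sound for every path, and randomness only guarantees that one of them
  exists. In the test, a small minimum means a lower bound \<open>- \<epsilon>\<close> on
  \<open>[a, b]\<close> together with an interior value below \<open>\<epsilon>\<close>. For
  \<open>a = 0\<close> the start at 0 makes the second half automatic, so staying above
  \<open>- \<epsilon>\<close> must itself be unlikely. An explicit bound for each level is required,
  which a qualitative statement about zeros accumulating at 0 would not give; comparing scales
  provides it from independence and second moments alone. Intervals reaching below 0 are decided
  directly, because 0 is a zero of every random path.\<close>

definition computable :: "nat \<Rightarrow> ((nat \<Rightarrow> nat) \<Rightarrow> nat list \<Rightarrow> nat) \<Rightarrow> bool" where
  "computable n f \<longleftrightarrow> (\<exists>p. \<forall>\<phi> xs. length xs = n \<longrightarrow> computes \<phi> p xs (f \<phi> xs))"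

text \<open>The rules follow the syntax of a term, so applying them exhaustively amounts to
  compiling the term into a \<open>prog\<close>, uniformly in the oracle.\<close>

named_theorems computable_intros

lemma computable_cong:
  assumes "computable n f" and "\<And>\<phi> xs. length xs = n \<Longrightarrow> f \<phi> xs = g \<phi> xs"
  shows "computable n g"
  using assms by (auto simp: computable_def)

lemma computable_comp:
  assumes f: "computable (length gs) f" and gs: "\<And>g. g \<in> set gs \<Longrightarrow> computable n g"
  shows "computable n (\<lambda>\<phi> xs. f \<phi> (map (\<lambda>g. g \<phi> xs) gs))"
proof -
  obtain p where p: "\<And>\<phi> xs. length xs = length gs \<Longrightarrow> computes \<phi> p xs (f \<phi> xs)"
    using f by (auto simp: computable_def)
  have "\<exists>q. \<forall>\<phi> xs. length xs = n \<longrightarrow> computes \<phi> q xs (g \<phi> xs)" if "g \<in> set gs" for g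
    using gs[OF that] by (simp add: computable_def)
  then obtain q where
    q: "\<And>g \<phi> xs. g \<in> set gs \<Longrightarrow> length xs = n \<Longrightarrow> computes \<phi> (q g) xs (g \<phi> xs)"
    by metis
  have "computes \<phi> (Comp p (map q gs)) xs (f \<phi> (map (\<lambda>g. g \<phi> xs) gs))" if "length xs = n" for \<phi> xs
    by (rule computes.comp[where ys = "map (\<lambda>g. g \<phi> xs) gs"])
      (auto simp: list_all2_conv_all_nth p q that)
  then show ?thesis
    unfolding computable_def by blast
qed

lemma computable_comp1:
  assumes "computable 1 (\<lambda>\<phi> xs. f \<phi> (xs ! 0))" "computable n g"
  shows "computable n (\<lambda>\<phi> xs. f \<phi> (g \<phi> xs))"
  using computable_comp[of "[g]" "\<lambda>\<phi> xs. f \<phi> (xs ! 0)" n] assms by simp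

lemma computable_nth [computable_intros]: "i < n \<Longrightarrow> computable n (\<lambda>\<phi> xs. xs ! i)"
  unfolding computable_def by (rule exI[of _ "Proj i"]) (auto intro: computes.proj)

lemma computable_oracle [computable_intros]:
  assumes "computable n g" shows "computable n (\<lambda>\<phi> xs. \<phi> (g \<phi> xs))"
proof (rule computable_comp1[OF _ assms, of "\<lambda>\<phi> x. \<phi> x"])
  have "computes \<phi> Query xs (\<phi> (xs ! 0))" if "length xs = 1" for \<phi> xs
    using that by (cases xs) (auto intro: computes.query)
  then show "computable 1 (\<lambda>\<phi> xs. \<phi> (xs ! 0))"
    by (auto simp: computable_def)
qed

lemma computable_Suc [computable_intros]:
  assumes "computable n g" shows "computable n (\<lambda>\<phi> xs. Suc (g \<phi> xs))"
proof (rule computable_comp1[OF _ assms, of "\<lambda>\<phi> x. Suc x"])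
  have "computes \<phi> Succ xs (Suc (xs ! 0))" if "length xs = 1" for \<phi> xs
    using that by (cases xs) (auto intro: computes.succ)
  then show "computable 1 (\<lambda>\<phi> xs. Suc (xs ! 0))"
    by (auto simp: computable_def)
qed

lemma computable_const [computable_intros]: "computable n (\<lambda>\<phi> xs. c)"
proof (induction c)
  case 0
  show ?case unfolding computable_def by (rule exI[of _ Zero]) (auto intro: computes.zero)
next
  case (Suc c)
  then show ?case by (rule computable_Suc)
qed

lemma map_nth_upt: "length xs = n \<Longrightarrow> map (\<lambda>i. xs ! i) [0..<n] = xs"
  by (auto intro: nth_equalityI)

lemma computable_tl [computable_intros]:
  assumes "computable n f" shows "computable (Suc n) (\<lambda>\<phi> xs. f \<phi> (tl xs))"
proof (rule computable_cong)
  show "computable (Suc n) (\<lambda>\<phi> xs. f \<phi> (map (\<lambda>g. g \<phi> xs) (map (\<lambda>i \<phi> xs. xs ! Suc i) [0..<n])))"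
    by (rule computable_comp) (use assms in \<open>auto intro: computable_nth\<close>)
next
  fix \<phi> :: "nat \<Rightarrow> nat" and xs :: "nat list" assume "length xs = Suc n"
  then have "map (\<lambda>g. g \<phi> xs) (map (\<lambda>i \<phi> xs. xs ! Suc i) [0..<n]) = tl xs"
    by (intro nth_equalityI) (auto simp: nth_tl)
  then show "f \<phi> (map (\<lambda>g. g \<phi> xs) (map (\<lambda>i \<phi> xs. xs ! Suc i) [0..<n])) = f \<phi> (tl xs)"
    by simp
qed

lemma computable_hd [computable_intros]: "computable (Suc n) (\<lambda>\<phi> xs. hd xs)"
  by (rule computable_cong[OF computable_nth[of 0]]) (auto simp: hd_conv_nth length_Suc_conv)

text \<open>A bound variable is pushed onto the front of the argument list: the body sees it as
  \<open>hd l\<close> and the outer arguments as \<open>tl l\<close>. All later rules for binders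
  use this convention. Substituting \<open>g\<close> is then composition with \<open>g\<close> and
  the projections.\<close>

lemma computable_Let:
  assumes f: "computable (Suc n) (\<lambda>\<phi> l. F \<phi> (tl l) (hd l))" and g: "computable n g"
  shows "computable n (\<lambda>\<phi> xs. F \<phi> xs (g \<phi> xs))"
proof (rule computable_cong)
  show "computable n (\<lambda>\<phi> xs. (\<lambda>\<phi> l. F \<phi> (tl l) (hd l)) \<phi>
      (map (\<lambda>h. h \<phi> xs) (g # map (\<lambda>i \<phi> xs. xs ! i) [0..<n])))"
    by (rule computable_comp) (use assms in \<open>auto intro: computable_nth\<close>)
qed (simp add: o_def map_nth_upt)

text \<open>\<open>PRec\<close> hands its step function the counter, the previous value and then the
  parameters, which explains \<open>hd l\<close>, \<open>hd (tl l)\<close> and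
  \<open>tl (tl l)\<close>. The program recurses on its first argument, for which
  \<open>computable_Let\<close> substitutes \<open>h\<close>.\<close>

lemma computable_rec_nat [computable_intros]:
  assumes f: "computable n f"
    and g: "computable (Suc (Suc n)) (\<lambda>\<phi> l. G \<phi> (tl (tl l)) (hd l) (hd (tl l)))"
    and h: "computable n h"
  shows "computable n (\<lambda>\<phi> xs. rec_nat (f \<phi> xs) (G \<phi> xs) (h \<phi> xs))"
proof -
  obtain p where p: "\<And>\<phi> xs. length xs = n \<Longrightarrow> computes \<phi> p xs (f \<phi> xs)"
    using f by (auto simp: computable_def)
  obtain q where q: "\<And>\<phi> xs. length xs = Suc (Suc n) \<Longrightarrow>
      computes \<phi> q xs (G \<phi> (tl (tl xs)) (hd xs) (hd (tl xs)))"
    using g by (auto simp: computable_def)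
  have rec: "computes \<phi> (PRec p q) (m # xs) (rec_nat (f \<phi> xs) (G \<phi> xs) m)"
    if "length xs = n" for \<phi> xs m
  proof (induction m)
    case 0
    show ?case using p[OF that] by (auto intro: computes.prec_0)
  next
    case (Suc m)
    then show ?case
      using q[of "m # rec_nat (f \<phi> xs) (G \<phi> xs) m # xs" \<phi>] that
      by (auto intro: computes.prec_Suc)
  qed
  have "computable (Suc n) (\<lambda>\<phi> l. rec_nat (f \<phi> (tl l)) (G \<phi> (tl l)) (hd l))"
    unfolding computable_def
  proof (intro exI allI impI)
    fix \<phi> and xs :: "nat list" assume "length xs = Suc n"
    then show "computes \<phi> (PRec p q) xs (rec_nat (f \<phi> (tl xs)) (G \<phi> (tl xs)) (hd xs))"
      using rec[of "tl xs" \<phi> "hd xs"] by (cases xs) auto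
  qed
  then show ?thesis
    by (rule computable_Let[where F = "\<lambda>\<phi> xs. rec_nat (f \<phi> xs) (G \<phi> xs)"]) (rule h)
qed

lemma computable_add [computable_intros]:
  assumes "computable n f" "computable n g"
  shows "computable n (\<lambda>\<phi> xs. f \<phi> xs + g \<phi> xs)"
proof -
  have eq: "rec_nat a (\<lambda>_. Suc) b = a + b" for a b
    by (induction b) auto
  have "computable n (\<lambda>\<phi> xs. rec_nat (f \<phi> xs) (\<lambda>_ y. Suc y) (g \<phi> xs))"
    by (intro computable_intros assms)
  then show ?thesis by (simp add: eq)
qed

lemma computable_mult [computable_intros]:
  assumes "computable n f" "computable n g"
  shows "computable n (\<lambda>\<phi> xs. f \<phi> xs * g \<phi> xs)"
proof -
  have eq: "rec_nat 0 (\<lambda>_ y. y + a) b = a * b" for a b :: nat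
    by (induction b) auto
  have "computable n (\<lambda>\<phi> xs. rec_nat 0 (\<lambda>_ y. y + f \<phi> xs) (g \<phi> xs))"
    by (intro computable_intros assms)
  then show ?thesis by (simp add: eq)
qed

lemma computable_power [computable_intros]:
  assumes "computable n f" "computable n g"
  shows "computable n (\<lambda>\<phi> xs. f \<phi> xs ^ g \<phi> xs)"
proof -
  have eq: "rec_nat 1 (\<lambda>_ y. y * a) b = a ^ b" for a b :: nat
    by (induction b) auto
  have "computable n (\<lambda>\<phi> xs. rec_nat 1 (\<lambda>_ y. y * f \<phi> xs) (g \<phi> xs))"
    by (intro computable_intros assms)
  then show ?thesis unfolding eq .
qed

lemma computable_minus [computable_intros]:
  assumes "computable n f" "computable n g"
  shows "computable n (\<lambda>\<phi> xs. f \<phi> xs - g \<phi> xs)"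
proof -
  have pred: "computable m (\<lambda>\<phi> xs. h \<phi> xs - 1)" if "computable m h" for m h
  proof -
    \<comment> \<open>A recursion that returns its counter computes the predecessor; iterating the
      predecessor gives truncated subtraction.\<close>
    have eq: "rec_nat 0 (\<lambda>k _. k) b = b - 1" for b :: nat
      by (cases b) auto
    have "computable m (\<lambda>\<phi> xs. rec_nat 0 (\<lambda>k _. k) (h \<phi> xs))"
      by (intro computable_intros that)
    then show ?thesis unfolding eq .
  qed
  have eq: "rec_nat a (\<lambda>_ y. y - 1) b = a - b" for a b :: nat
    by (induction b) auto
  have "computable n (\<lambda>\<phi> xs. rec_nat (f \<phi> xs) (\<lambda>_ y. y - 1) (g \<phi> xs))"
    by (intro computable_intros pred assms)
  then show ?thesis unfolding eq .
qed

text \<open>Inside a recursion or a second binder, the list carries one more entry behind the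
  current index. A body that depends only on the index and the outer arguments has to skip
  it.\<close>

lemma computable_drop_second:
  assumes "computable (Suc n) (\<lambda>\<phi> l. F \<phi> (tl l) (hd l))"
  shows "computable (Suc (Suc n)) (\<lambda>\<phi> l. F \<phi> (tl (tl l)) (hd l))"
proof (rule computable_cong)
  let ?gs = "(\<lambda>\<phi> xs. xs ! 0) # map (\<lambda>i \<phi> xs. xs ! Suc (Suc i)) [0..<n]"
  show "computable (Suc (Suc n)) (\<lambda>\<phi> xs. (\<lambda>\<phi> l. F \<phi> (tl l) (hd l)) \<phi> (map (\<lambda>g. g \<phi> xs) ?gs))"
    by (rule computable_comp) (use assms in \<open>auto intro: computable_nth\<close>)
  fix \<phi> and xs :: "nat list" assume "length xs = Suc (Suc n)"
  then have "map (\<lambda>i. xs ! Suc (Suc i)) [0..<n] = tl (tl xs)" "xs ! 0 = hd xs"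
    by (auto intro!: nth_equalityI simp: nth_tl hd_conv_nth length_Suc_conv)
  then show "F \<phi> (tl (map (\<lambda>g. g \<phi> xs) ?gs)) (hd (map (\<lambda>g. g \<phi> xs) ?gs)) = F \<phi> (tl (tl xs)) (hd xs)"
    by (simp add: o_def)
qed

lemma computable_sum [computable_intros]:
  assumes "computable (Suc n) (\<lambda>\<phi> l. F \<phi> (tl l) (hd l))" "computable n b"
  shows "computable n (\<lambda>\<phi> xs. \<Sum>j<b \<phi> xs. F \<phi> xs j)"
proof -
  have eq: "rec_nat 0 (\<lambda>m y. y + f m) b = (\<Sum>j<b. f j)" for f :: "nat \<Rightarrow> nat" and b
    by (induction b) auto
  have "computable n (\<lambda>\<phi> xs. rec_nat 0 (\<lambda>m y. y + F \<phi> xs m) (b \<phi> xs))"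
    by (intro computable_intros computable_drop_second assms)
  then show ?thesis unfolding eq .
qed

lemma computable_prod [computable_intros]:
  assumes "computable (Suc n) (\<lambda>\<phi> l. F \<phi> (tl l) (hd l))" "computable n b"
  shows "computable n (\<lambda>\<phi> xs. \<Prod>j<b \<phi> xs. F \<phi> xs j)"
proof -
  have eq: "rec_nat 1 (\<lambda>m y. y * f m) b = (\<Prod>j<b. f j)" for f :: "nat \<Rightarrow> nat" and b
    by (induction b) auto
  have "computable n (\<lambda>\<phi> xs. rec_nat 1 (\<lambda>m y. y * F \<phi> xs m) (b \<phi> xs))"
    by (intro computable_intros computable_drop_second assms)
  then show ?thesis unfolding eq .
qed

lemma computable_funpow [computable_intros]:
  assumes "computable (Suc n) (\<lambda>\<phi> l. F \<phi> (tl l) (hd l))" "computable n b" "computable n a"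
  shows "computable n (\<lambda>\<phi> xs. (F \<phi> xs ^^ b \<phi> xs) (a \<phi> xs))"
proof -
  have eq: "rec_nat a (\<lambda>_ y. f y) b = (f ^^ b) a" for f :: "nat \<Rightarrow> nat" and a b
    by (induction b) auto
  have "computable n (\<lambda>\<phi> xs. rec_nat (a \<phi> xs) (\<lambda>_ y. F \<phi> xs y) (b \<phi> xs))"
    by (intro computable_intros computable_tl[OF assms(1)] assms)
  then show ?thesis unfolding eq .
qed


section \<open>Decidable predicates\<close>

definition decidable :: "nat \<Rightarrow> ((nat \<Rightarrow> nat) \<Rightarrow> nat list \<Rightarrow> bool) \<Rightarrow> bool" where
  "decidable n P \<longleftrightarrow> computable n (\<lambda>\<phi> xs. of_bool (P \<phi> xs))"

lemma computable_of_bool [computable_intros]: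
  "decidable n P \<Longrightarrow> computable n (\<lambda>\<phi> xs. of_bool (P \<phi> xs))"
  by (simp add: decidable_def)

lemma decidable_cong:
  assumes "decidable n P" and "\<And>\<phi> xs. length xs = n \<Longrightarrow> P \<phi> xs = Q \<phi> xs"
  shows "decidable n Q"
  using assms unfolding decidable_def by (auto elim: computable_cong)

lemma decidable_less [computable_intros]:
  assumes "computable n f" "computable n g"
  shows "decidable n (\<lambda>\<phi> xs. f \<phi> xs < g \<phi> xs)"
proof -
  have "computable n (\<lambda>\<phi> xs. 1 - (1 - (g \<phi> xs - f \<phi> xs)))"
    by (intro computable_intros assms)
  moreover have "1 - (1 - (b - a)) = of_bool (a < b)" for a b :: nat
    by auto
  ultimately show ?thesis by (simp add: decidable_def)
qed

lemma decidable_not [computable_intros]: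
  assumes "decidable n P" shows "decidable n (\<lambda>\<phi> xs. \<not> P \<phi> xs)"
proof -
  have "computable n (\<lambda>\<phi> xs. 1 - of_bool (P \<phi> xs))"
    by (intro computable_intros assms)
  then show ?thesis
    unfolding decidable_def by (rule computable_cong) auto
qed

lemma decidable_conj [computable_intros]:
  assumes "decidable n P" "decidable n Q" shows "decidable n (\<lambda>\<phi> xs. P \<phi> xs \<and> Q \<phi> xs)"
proof -
  have "computable n (\<lambda>\<phi> xs. of_bool (P \<phi> xs) * of_bool (Q \<phi> xs))"
    by (intro computable_intros assms)
  then show ?thesis unfolding decidable_def of_bool_conj .
qed

lemma decidable_disj [computable_intros]:
  assumes "decidable n P" "decidable n Q" shows "decidable n (\<lambda>\<phi> xs. P \<phi> xs \<or> Q \<phi> xs)"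
proof -
  have "decidable n (\<lambda>\<phi> xs. \<not> (\<not> P \<phi> xs \<and> \<not> Q \<phi> xs))"
    by (intro computable_intros assms)
  then show ?thesis by simp
qed

lemma decidable_imp [computable_intros]:
  assumes "decidable n P" "decidable n Q" shows "decidable n (\<lambda>\<phi> xs. P \<phi> xs \<longrightarrow> Q \<phi> xs)"
proof -
  have "decidable n (\<lambda>\<phi> xs. \<not> P \<phi> xs \<or> Q \<phi> xs)"
    by (intro computable_intros assms)
  then show ?thesis by simp
qed

lemma decidable_le [computable_intros]:
  assumes "computable n f" "computable n g"
  shows "decidable n (\<lambda>\<phi> xs. f \<phi> xs \<le> g \<phi> xs)"
  unfolding not_less[symmetric] by (intro computable_intros assms)

lemma decidable_eq [computable_intros]:
  assumes "computable n f" "computable n g"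
  shows "decidable n (\<lambda>\<phi> xs. f \<phi> xs = g \<phi> xs)"
  unfolding order.eq_iff by (intro computable_intros assms)

lemma decidable_all [computable_intros]:
  assumes "decidable (Suc n) (\<lambda>\<phi> l. P \<phi> (tl l) (hd l))" "computable n b"
  shows "decidable n (\<lambda>\<phi> xs. \<forall>j<b \<phi> xs. P \<phi> xs j)"
proof -
  have "decidable n (\<lambda>\<phi> xs. (\<Sum>j<b \<phi> xs. of_bool (\<not> P \<phi> xs j)) = (0::nat))"
    by (intro computable_intros assms)
  then show ?thesis by (rule decidable_cong) auto
qed

lemma decidable_ex [computable_intros]:
  assumes "decidable (Suc n) (\<lambda>\<phi> l. P \<phi> (tl l) (hd l))" "computable n b"
  shows "decidable n (\<lambda>\<phi> xs. \<exists>j<b \<phi> xs. P \<phi> xs j)"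
proof -
  have "decidable n (\<lambda>\<phi> xs. \<not> (\<forall>j<b \<phi> xs. \<not> P \<phi> xs j))"
    by (intro computable_intros assms)
  then show ?thesis by simp
qed

lemma computable_if [computable_intros]:
  assumes "decidable n P" "computable n f" "computable n g"
  shows "computable n (\<lambda>\<phi> xs. if P \<phi> xs then f \<phi> xs else g \<phi> xs)"
proof -
  have "computable n (\<lambda>\<phi> xs. of_bool (P \<phi> xs) * f \<phi> xs + of_bool (\<not> P \<phi> xs) * g \<phi> xs)"
    by (intro computable_intros assms)
  then show ?thesis by (rule computable_cong) simp
qed

lemma computable_div [computable_intros]:
  assumes "computable n f" "computable n g"
  shows "computable n (\<lambda>\<phi> xs. f \<phi> xs div g \<phi> xs)"
proof -
  \<comment> \<open>The quotient counts the positive multiples of the divisor up to the dividend.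
    Divisor 0 is separated because every \<open>k\<close> would be counted, whereas
    \<open>a div 0 = 0\<close>.\<close>
  have "computable n (\<lambda>\<phi> xs. if g \<phi> xs = 0 then 0 else \<Sum>k<f \<phi> xs. of_bool (Suc k * g \<phi> xs \<le> f \<phi> xs))"
    by (intro computable_intros assms)
  moreover have "(if b = 0 then 0 else \<Sum>k<a. of_bool (Suc k * b \<le> a)) = a div b" for a b :: nat
  proof (cases "b = 0")
    case False
    then have "(Suc k * b \<le> a) = (k < a div b)" for k
      by (metis Suc_le_eq gr0I less_eq_div_iff_mult_less_eq)
    moreover have "{k. k < a \<and> k < a div b} = {..<a div b}"
      using div_le_dividend[of a b] order.strict_trans2 by blast
    ultimately show ?thesis
      using False by (simp add: sum.If_cases of_bool_def Int_def lessThan_def del: mult_Suc)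
  qed simp
  ultimately show ?thesis by simp
qed

lemma decidable_even [computable_intros]:
  assumes "computable n f" shows "decidable n (\<lambda>\<phi> xs. even (f \<phi> xs))"
proof -
  have "decidable n (\<lambda>\<phi> xs. 2 * (f \<phi> xs div 2) = f \<phi> xs)"
    by (intro computable_intros assms)
  moreover have "(2 * (a div 2) = a) = even a" for a :: nat
    by presburger
  ultimately show ?thesis by simp
qed

section \<open>Codes of pairs and lists\<close>

lemma computable_prod_encode [computable_intros]:
  assumes "computable n f" "computable n g"
  shows "computable n (\<lambda>\<phi> xs. prod_encode (f \<phi> xs, g \<phi> xs))"
  unfolding prod_encode_def prod.case triangle_def by (intro computable_intros assms)

text \<open>The pairing is inverted by bounded search: both components of \<open>x\<close> are at
  most \<open>x\<close>, and exactly one pair contributes to the double sum.\<close>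

lemma prod_decode_eq_sum:
  "fst (prod_decode x) = (\<Sum>a<Suc x. \<Sum>b<Suc x. of_bool (prod_encode (a, b) = x) * a)"
  "snd (prod_decode x) = (\<Sum>a<Suc x. \<Sum>b<Suc x. of_bool (prod_encode (a, b) = x) * b)"
proof -
  obtain c d where cd: "prod_decode x = (c, d)" by force
  then have x: "x = prod_encode (c, d)" by (metis prod_decode_inverse)
  have *: "(prod_encode (a, b) = x) = (a = c \<and> b = d)" for a b
    by (auto simp: x)
  have le: "c < Suc x" "d < Suc x"
    using le_prod_encode_1[of c d] le_prod_encode_2[of d c] x by auto
  have sum: "(\<Sum>a<Suc x. \<Sum>b<Suc x. of_bool (prod_encode (a, b) = x) * g a b) = g c d"
    for g :: "nat \<Rightarrow> nat \<Rightarrow> nat"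
  proof -
    have "(\<Sum>b<Suc x. of_bool (prod_encode (a, b) = x) * g a b) = (if a = c then g c d else 0)" for a
    proof -
      have "(\<Sum>b<Suc x. of_bool (prod_encode (a, b) = x) * g a b)
          = (\<Sum>b<Suc x. if b = d then (if a = c then g c d else 0) else 0)"
        by (intro sum.cong) (auto simp: *)
      then show ?thesis using le by (simp only: sum.delta finite_lessThan lessThan_iff if_True)
    qed
    then show ?thesis using le by (simp only: sum.delta finite_lessThan lessThan_iff if_True)
  qed
  show "fst (prod_decode x) = (\<Sum>a<Suc x. \<Sum>b<Suc x. of_bool (prod_encode (a, b) = x) * a)"
    "snd (prod_decode x) = (\<Sum>a<Suc x. \<Sum>b<Suc x. of_bool (prod_encode (a, b) = x) * b)"
    unfolding sum by (simp_all add: cd)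
qed

lemma computable_prod_decode [computable_intros]:
  assumes "computable n f"
  shows "computable n (\<lambda>\<phi> xs. fst (prod_decode (f \<phi> xs)))"
    and "computable n (\<lambda>\<phi> xs. snd (prod_decode (f \<phi> xs)))"
  unfolding prod_decode_eq_sum by (intro computable_intros assms)+

text \<open>A nonempty list has code \<open>Suc m\<close>, where \<open>m\<close> pairs its head
  with the code of its tail; the iterated function therefore takes tails. The empty list has code 0,
  which stays fixed since \<open>0 - 1 = 0\<close> and
  \<open>snd (prod_decode 0) = 0\<close>.\<close>

definition code_drop :: "nat \<Rightarrow> nat \<Rightarrow> nat" where
  "code_drop i k = ((\<lambda>m. snd (prod_decode (m - 1))) ^^ i) k"

definition code_nth :: "nat \<Rightarrow> nat \<Rightarrow> nat" where
  "code_nth k i = fst (prod_decode (code_drop i k - 1))"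

lemma snd_prod_decode_0 [simp]: "snd (prod_decode 0) = 0"
  by (simp add: prod_decode_eq_sum)

lemma list_decode_code_drop: "list_decode (code_drop i k) = drop i (list_decode k)"
proof (induction i)
  case (Suc i)
  have "list_decode (snd (prod_decode (m - 1))) = tl (list_decode m)" for m
    by (cases m) (auto split: prod.split)
  with Suc show ?case
    by (simp add: code_drop_def drop_Suc drop_tl)
qed (simp add: code_drop_def)

lemma list_decode_eq_Nil_iff: "list_decode k = [] \<longleftrightarrow> k = 0"
  by (cases k) (auto split: prod.split)

lemma code_drop_eq_0_iff: "code_drop i k = 0 \<longleftrightarrow> length (list_decode k) \<le> i"
  using list_decode_eq_Nil_iff[of "code_drop i k"] by (simp add: list_decode_code_drop)

lemma list_decode_nth:
  assumes "i < length (list_decode k)" shows "list_decode k ! i = code_nth k i"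
proof -
  obtain m where m: "code_drop i k = Suc m"
    using code_drop_eq_0_iff[of i k] assms by (cases "code_drop i k") auto
  then have "list_decode (code_drop i k) = fst (prod_decode m) # list_decode (snd (prod_decode m))"
    by (simp add: split_beta)
  then have "list_decode k ! i = fst (prod_decode m)"
    using assms by (metis Cons_nth_drop_Suc list.inject list_decode_code_drop)
  then show ?thesis by (simp add: code_nth_def m)
qed

lemma length_list_decode_le: "length (list_decode k) \<le> k"
proof (induction k rule: less_induct)
  case (less k)
  show ?case
  proof (cases k)
    case (Suc m)
    have "snd (prod_decode m) \<le> m"
      using le_prod_encode_2[of "snd (prod_decode m)" "fst (prod_decode m)"] by simp
    with less[of "snd (prod_decode m)"] Suc show ?thesis
      by (auto simp: split_beta)
  qed simp
qed

text \<open>The code bounds the length, so it suffices to count the positions below \<open>k\<close>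
  at which a nonempty rest remains.\<close>

lemma length_list_decode_eq_sum:
  "length (list_decode k) = (\<Sum>i<k. of_bool (code_drop i k \<noteq> 0))"
proof -
  have "{i. i < k \<and> i < length (list_decode k)} = {..<length (list_decode k)}"
    using length_list_decode_le[of k] by auto
  then show ?thesis
    by (simp add: code_drop_eq_0_iff not_le of_bool_def sum.If_cases Int_def lessThan_def)
qed

lemma computable_code_nth [computable_intros]:
  assumes "computable n f" "computable n g"
  shows "computable n (\<lambda>\<phi> xs. code_nth (f \<phi> xs) (g \<phi> xs))"
  unfolding code_nth_def code_drop_def by (intro computable_intros assms)

lemma computable_length_list_decode [computable_intros]:
  assumes "computable n f"
  shows "computable n (\<lambda>\<phi> xs. length (list_decode (f \<phi> xs)))"
  unfolding length_list_decode_eq_sum code_drop_def by (intro computable_intros assms)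


section \<open>Computable rational-valued functions\<close>

text \<open>Unreduced fractions: the numerator is a difference of naturals, which avoids integers,
  and the denominator is a successor, hence never 0. Comparisons only need the sign of a numerator,
  so no normal form is required.\<close>

definition computable_rat :: "nat \<Rightarrow> ((nat \<Rightarrow> nat) \<Rightarrow> nat list \<Rightarrow> real) \<Rightarrow> bool" where
  "computable_rat n f \<longleftrightarrow> (\<exists>x y z. computable n x \<and> computable n y \<and> computable n z \<and>
     (\<forall>\<phi> xs. length xs = n \<longrightarrow> f \<phi> xs = (real (x \<phi> xs) - real (y \<phi> xs)) / real (Suc (z \<phi> xs))))"

lemma computable_ratI:
  assumes "computable n x" "computable n y" "computable n z"
    and "\<And>\<phi> xs. length xs = n \<Longrightarrow> f \<phi> xs = (real (x \<phi> xs) - real (y \<phi> xs)) / real (Suc (z \<phi> xs))"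
  shows "computable_rat n f"
  using assms unfolding computable_rat_def by blast

lemma computable_ratE:
  assumes "computable_rat n f"
  obtains x y z where "computable n x" "computable n y" "computable n z"
    and "\<And>\<phi> xs. length xs = n \<Longrightarrow> f \<phi> xs = (real (x \<phi> xs) - real (y \<phi> xs)) / real (Suc (z \<phi> xs))"
  using assms unfolding computable_rat_def by blast

lemma computable_rat_tl [computable_intros]:
  assumes "computable_rat n f" shows "computable_rat (Suc n) (\<lambda>\<phi> xs. f \<phi> (tl xs))"
  using assms
proof (rule computable_ratE)
  fix x y z assume *: "computable n x" "computable n y" "computable n z"
    "\<And>\<phi> xs. length xs = n \<Longrightarrow> f \<phi> xs = (real (x \<phi> xs) - real (y \<phi> xs)) / real (Suc (z \<phi> xs))"
  show ?thesis
    by (rule computable_ratI[of _ "\<lambda>\<phi> xs. x \<phi> (tl xs)" "\<lambda>\<phi> xs. y \<phi> (tl xs)" "\<lambda>\<phi> xs. z \<phi> (tl xs)"])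
      (simp_all add: * computable_tl)
qed

lemma computable_rat_of_nat [computable_intros]:
  "computable n f \<Longrightarrow> computable_rat n (\<lambda>\<phi> xs. real (f \<phi> xs))"
  by (rule computable_ratI[of _ f "\<lambda>_ _. 0" "\<lambda>_ _. 0"]) (auto intro: computable_intros)

lemma computable_rat_diff [computable_intros]:
  assumes "computable_rat n f" "computable_rat n g"
  shows "computable_rat n (\<lambda>\<phi> xs. f \<phi> xs - g \<phi> xs)"
proof -
  obtain x y z where f: "computable n x" "computable n y" "computable n z"
    "\<And>\<phi> xs. length xs = n \<Longrightarrow> f \<phi> xs = (real (x \<phi> xs) - real (y \<phi> xs)) / real (Suc (z \<phi> xs))"
    using assms(1) by (rule computable_ratE) blast
  obtain x' y' z' where g: "computable n x'" "computable n y'" "computable n z'"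
    "\<And>\<phi> xs. length xs = n \<Longrightarrow> g \<phi> xs = (real (x' \<phi> xs) - real (y' \<phi> xs)) / real (Suc (z' \<phi> xs))"
    using assms(2) by (rule computable_ratE) blast
  show ?thesis
  proof (rule computable_ratI)
    show "computable n (\<lambda>\<phi> xs. x \<phi> xs * Suc (z' \<phi> xs) + y' \<phi> xs * Suc (z \<phi> xs))"
      "computable n (\<lambda>\<phi> xs. y \<phi> xs * Suc (z' \<phi> xs) + x' \<phi> xs * Suc (z \<phi> xs))"
      \<comment> \<open>The predecessor of the common denominator
        \<open>(z + 1) * (z' + 1)\<close>.\<close>
      "computable n (\<lambda>\<phi> xs. z \<phi> xs * z' \<phi> xs + z \<phi> xs + z' \<phi> xs)"
      by (intro computable_intros f g)+
  next
    fix \<phi> :: "nat \<Rightarrow> nat" and xs :: "nat list" assume "length xs = n"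
    moreover have "real (Suc (z \<phi> xs * z' \<phi> xs + z \<phi> xs + z' \<phi> xs)) =
        real (Suc (z \<phi> xs)) * real (Suc (z' \<phi> xs))"
      by (simp add: algebra_simps)
    ultimately show "f \<phi> xs - g \<phi> xs =
        (real (x \<phi> xs * Suc (z' \<phi> xs) + y' \<phi> xs * Suc (z \<phi> xs)) -
         real (y \<phi> xs * Suc (z' \<phi> xs) + x' \<phi> xs * Suc (z \<phi> xs))) /
         real (Suc (z \<phi> xs * z' \<phi> xs + z \<phi> xs + z' \<phi> xs))"
      by (simp only: f g) (simp add: divide_simps, simp add: algebra_simps)
  qed
qed

lemma computable_rat_mult [computable_intros]:
  assumes "computable_rat n f" "computable_rat n g"
  shows "computable_rat n (\<lambda>\<phi> xs. f \<phi> xs * g \<phi> xs)"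
proof -
  obtain x y z where f: "computable n x" "computable n y" "computable n z"
    "\<And>\<phi> xs. length xs = n \<Longrightarrow> f \<phi> xs = (real (x \<phi> xs) - real (y \<phi> xs)) / real (Suc (z \<phi> xs))"
    using assms(1) by (rule computable_ratE) blast
  obtain x' y' z' where g: "computable n x'" "computable n y'" "computable n z'"
    "\<And>\<phi> xs. length xs = n \<Longrightarrow> g \<phi> xs = (real (x' \<phi> xs) - real (y' \<phi> xs)) / real (Suc (z' \<phi> xs))"
    using assms(2) by (rule computable_ratE) blast
  show ?thesis
  proof (rule computable_ratI)
    show "computable n (\<lambda>\<phi> xs. x \<phi> xs * x' \<phi> xs + y \<phi> xs * y' \<phi> xs)"
      "computable n (\<lambda>\<phi> xs. x \<phi> xs * y' \<phi> xs + y \<phi> xs * x' \<phi> xs)"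
      "computable n (\<lambda>\<phi> xs. z \<phi> xs * z' \<phi> xs + z \<phi> xs + z' \<phi> xs)"
      by (intro computable_intros f g)+
  next
    fix \<phi> :: "nat \<Rightarrow> nat" and xs :: "nat list" assume "length xs = n"
    moreover have "real (Suc (z \<phi> xs * z' \<phi> xs + z \<phi> xs + z' \<phi> xs)) =
        real (Suc (z \<phi> xs)) * real (Suc (z' \<phi> xs))"
      by (simp add: algebra_simps)
    ultimately show "f \<phi> xs * g \<phi> xs =
        (real (x \<phi> xs * x' \<phi> xs + y \<phi> xs * y' \<phi> xs) - real (x \<phi> xs * y' \<phi> xs + y \<phi> xs * x' \<phi> xs)) /
         real (Suc (z \<phi> xs * z' \<phi> xs + z \<phi> xs + z' \<phi> xs))"
      by (simp only: f g) (simp add: divide_simps, simp add: algebra_simps)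
  qed
qed

lemma computable_rat_uminus [computable_intros]:
  assumes "computable_rat n f" shows "computable_rat n (\<lambda>\<phi> xs. - f \<phi> xs)"
proof -
  have "computable_rat n (\<lambda>\<phi> xs. real 0 - f \<phi> xs)"
    by (intro computable_intros assms)
  then show ?thesis by simp
qed

lemma computable_rat_add [computable_intros]:
  assumes "computable_rat n f" "computable_rat n g"
  shows "computable_rat n (\<lambda>\<phi> xs. f \<phi> xs + g \<phi> xs)"
proof -
  have "computable_rat n (\<lambda>\<phi> xs. f \<phi> xs - - g \<phi> xs)"
    by (intro computable_intros assms)
  then show ?thesis by simp
qed

lemma computable_rat_abs [computable_intros]:
  assumes "computable_rat n f" shows "computable_rat n (\<lambda>\<phi> xs. \<bar>f \<phi> xs\<bar>)"
  using assms
proof (rule computable_ratE)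
  fix x y z assume *: "computable n x" "computable n y" "computable n z"
    "\<And>\<phi> xs. length xs = n \<Longrightarrow> f \<phi> xs = (real (x \<phi> xs) - real (y \<phi> xs)) / real (Suc (z \<phi> xs))"
  show ?thesis
  proof (rule computable_ratI)
    show "computable n (\<lambda>\<phi> xs. (x \<phi> xs - y \<phi> xs) + (y \<phi> xs - x \<phi> xs))" "computable n (\<lambda>\<phi> xs. 0)"
      "computable n z"
      by (intro computable_intros *)+
    fix \<phi> :: "nat \<Rightarrow> nat" and xs :: "nat list" assume "length xs = n"
    then show "\<bar>f \<phi> xs\<bar> = (real (x \<phi> xs - y \<phi> xs + (y \<phi> xs - x \<phi> xs)) - real 0) / real (Suc (z \<phi> xs))"
      by (cases "x \<phi> xs \<le> y \<phi> xs") (simp_all add: * of_nat_diff)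
  qed
qed

lemma computable_rat_divide_Suc [computable_intros]:
  assumes "computable_rat n f" "computable n k"
  shows "computable_rat n (\<lambda>\<phi> xs. f \<phi> xs / real (Suc (k \<phi> xs)))"
proof -
  have "computable_rat n (\<lambda>\<phi> xs. (real 1 - real 0) / real (Suc (k \<phi> xs)))"
    by (rule computable_ratI[of _ "\<lambda>_ _. 1" "\<lambda>_ _. 0" k]) (auto intro: computable_intros assms)
  then have "computable_rat n (\<lambda>\<phi> xs. f \<phi> xs * ((real 1 - real 0) / real (Suc (k \<phi> xs))))"
    by (intro computable_intros assms)
  then show ?thesis by simp
qed

lemma computable_rat_power_half [computable_intros]:
  assumes "computable n f" shows "computable_rat n (\<lambda>\<phi> xs. (1/2) ^ f \<phi> xs)"
proof -
  have "computable_rat n (\<lambda>\<phi> xs. real 1 / real (Suc (2 ^ f \<phi> xs - 1)))"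
    by (intro computable_intros assms)
  moreover have "real 1 / real (Suc (2 ^ k - 1)) = (1/2) ^ k" for k :: nat
    by (simp add: Suc_diff_1 power_one_over)
  ultimately show ?thesis by simp
qed

lemma real_of_int_decode:
  "real_of_int (int_decode c) =
    real (if even c then c div 2 else 0) - real (if even c then 0 else Suc (c div 2))"
  by (simp add: int_decode_def sum_decode_def of_nat_diff)

lemma rat_code_eq:
  "rat_code c = real_of_int (int_decode (fst (prod_decode c))) / real_of_int (int_decode (snd (prod_decode c)))"
  by (simp add: rat_code_def nat_to_rat_surj_def split_beta of_rat_rat of_rat_divide Fract_of_int_quotient)

lemma computable_rat_rat_code [computable_intros]:
  assumes f: "computable n f" shows "computable_rat n (\<lambda>\<phi> xs. rat_code (f \<phi> xs))"
proof -
  let ?a = "\<lambda>\<phi> xs. fst (prod_decode (f \<phi> xs))" and ?b = "\<lambda>\<phi> xs. snd (prod_decode (f \<phi> xs))"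
  have num: "computable_rat n (\<lambda>\<phi> xs. real_of_int (int_decode (?a \<phi> xs)))"
    unfolding real_of_int_decode by (intro computable_intros f)
  \<comment> \<open>Even codes \<open>b\<close> decode to \<open>b div 2\<close>, odd ones to
    \<open>- Suc (b div 2)\<close>; each parity contributes its own reciprocal. For
    \<open>b = 0\<close> both terms vanish, in agreement with \<open>inverse 0 = 0\<close>.\<close>
  have inv: "computable_rat n (\<lambda>\<phi> xs.
      real (if even (?b \<phi> xs) \<and> ?b \<phi> xs \<noteq> 0 then 1 else 0) / real (Suc (?b \<phi> xs div 2 - 1)) -
      real (if even (?b \<phi> xs) then 0 else 1) / real (Suc (?b \<phi> xs div 2)))"
    by (intro computable_intros f)
  have eq: "real (if even b \<and> b \<noteq> 0 then 1 else 0) / real (Suc (b div 2 - 1)) -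
      real (if even b then 0 else 1) / real (Suc (b div 2)) = inverse (real_of_int (int_decode b))" for b
  proof (cases "even b")
    case True
    then show ?thesis
      unfolding real_of_int_decode by (auto simp: Suc_diff_1 inverse_eq_divide elim!: evenE)
  next
    case False
    then have "real_of_int (int_decode b) = - real (Suc (b div 2))"
      unfolding real_of_int_decode by simp
    then have "inverse (real_of_int (int_decode b)) = - (1 / real (Suc (b div 2)))"
      by (simp only: inverse_eq_divide minus_divide_right)
    with False show ?thesis by simp
  qed
  have "computable_rat n (\<lambda>\<phi> xs. real_of_int (int_decode (?a \<phi> xs)) * inverse (real_of_int (int_decode (?b \<phi> xs))))"
    using num inv unfolding eq by (rule computable_rat_mult)
  then show ?thesis by (simp add: rat_code_eq divide_inverse)
qed

lemma rat_code_surj: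
  assumes "q \<in> \<rat>" obtains c where "rat_code c = q"
  using surj_of_rat_nat_to_rat_surj[OF assms] unfolding rat_code_def by metis

lemma computable_rat_const [computable_intros]:
  assumes "q \<in> \<rat>" shows "computable_rat n (\<lambda>_ _. q)"
proof -
  obtain c where "rat_code c = q" using rat_code_surj[OF assms] .
  moreover have "computable_rat n (\<lambda>_ _. rat_code c)" by (intro computable_intros)
  ultimately show ?thesis by simp
qed

lemma decidable_rat_less [computable_intros]:
  assumes "computable_rat n f" "computable_rat n g"
  shows "decidable n (\<lambda>\<phi> xs. f \<phi> xs < g \<phi> xs)"
  using computable_rat_diff[OF assms]
proof (rule computable_ratE)
  fix x y z assume *: "computable n x" "computable n y" "computable n z"
    "\<And>\<phi> xs. length xs = n \<Longrightarrow> f \<phi> xs - g \<phi> xs = (real (x \<phi> xs) - real (y \<phi> xs)) / real (Suc (z \<phi> xs))"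
  have "decidable n (\<lambda>\<phi> xs. x \<phi> xs < y \<phi> xs)"
    by (intro computable_intros *)
  then show ?thesis
  proof (rule decidable_cong)
    fix \<phi> :: "nat \<Rightarrow> nat" and xs :: "nat list" assume "length xs = n"
    then have "f \<phi> xs < g \<phi> xs \<longleftrightarrow> (real (x \<phi> xs) - real (y \<phi> xs)) / real (Suc (z \<phi> xs)) < 0"
      using *(4) by (metis diff_less_0_iff_less)
    then show "(x \<phi> xs < y \<phi> xs) = (f \<phi> xs < g \<phi> xs)"
      by (simp add: divide_less_0_iff)
  qed
qed

lemma decidable_rat_le [computable_intros]:
  assumes "computable_rat n f" "computable_rat n g"
  shows "decidable n (\<lambda>\<phi> xs. f \<phi> xs \<le> g \<phi> xs)"
  unfolding not_less[symmetric] by (intro computable_intros assms)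

lemma computable_rat_max_0 [computable_intros]:
  assumes "computable_rat n f" shows "computable_rat n (\<lambda>\<phi> xs. max 0 (f \<phi> xs))"
proof -
  have "computable_rat n (\<lambda>\<phi> xs. (f \<phi> xs + \<bar>f \<phi> xs\<bar>) / real (Suc 1))"
    by (intro computable_intros assms)
  moreover have "(a + \<bar>a\<bar>) / real (Suc 1) = max 0 a" for a :: real
    by (simp add: max_def)
  ultimately show ?thesis by simp
qed

lemma computable_rat_sum [computable_intros]:
  assumes "computable_rat (Suc n) (\<lambda>\<phi> l. F \<phi> (tl l) (hd l))" and b: "computable n b"
  shows "computable_rat n (\<lambda>\<phi> xs. \<Sum>j<b \<phi> xs. F \<phi> xs j)"
  using assms(1)
proof (rule computable_ratE)
  fix x y z assume *: "computable (Suc n) x" "computable (Suc n) y" "computable (Suc n) z"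
    "\<And>\<phi> xs. length xs = Suc n \<Longrightarrow> F \<phi> (tl xs) (hd xs) = (real (x \<phi> xs) - real (y \<phi> xs)) / real (Suc (z \<phi> xs))"
  have cons: "computable (Suc n) (\<lambda>\<phi> l. h \<phi> (hd l # tl l))" if "computable (Suc n) h" for h
    by (rule computable_cong[OF that]) (auto simp: length_Suc_conv)
  \<comment> \<open>The product of all denominators serves as the common one; each numerator is
    scaled by the exact quotient of \<open>D\<close> by its own denominator.\<close>
  define D where "D \<phi> xs = (\<Prod>j<b \<phi> xs. Suc (z \<phi> (j # xs)))" for \<phi> xs
  have D: "computable n D"
    unfolding D_def by (intro computable_intros b cons *)
  show ?thesis
  proof (rule computable_ratI)
    show "computable n (\<lambda>\<phi> xs. \<Sum>j<b \<phi> xs. x \<phi> (j # xs) * (D \<phi> xs div Suc (z \<phi> (j # xs))))"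
      "computable n (\<lambda>\<phi> xs. \<Sum>j<b \<phi> xs. y \<phi> (j # xs) * (D \<phi> xs div Suc (z \<phi> (j # xs))))"
      "computable n (\<lambda>\<phi> xs. D \<phi> xs - 1)"
      by (intro computable_intros b cons D *)+
    fix \<phi> :: "nat \<Rightarrow> nat" and xs :: "nat list" assume xs: "length xs = n"
    have pos: "D \<phi> xs > 0"
      unfolding D_def by (intro prod_pos) auto
    have "real (D \<phi> xs div Suc (z \<phi> (j # xs))) = real (D \<phi> xs) / real (Suc (z \<phi> (j # xs)))"
      if "j < b \<phi> xs" for j
    proof (rule real_of_nat_div)
      show "Suc (z \<phi> (j # xs)) dvd D \<phi> xs"
        unfolding D_def using that by (intro dvd_prodI) auto
    qed
    then have "real (\<Sum>j<b \<phi> xs. h \<phi> (j # xs) * (D \<phi> xs div Suc (z \<phi> (j # xs))))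
        = real (D \<phi> xs) * (\<Sum>j<b \<phi> xs. real (h \<phi> (j # xs)) / real (Suc (z \<phi> (j # xs))))" for h
      unfolding sum_distrib_left of_nat_sum of_nat_mult by (intro sum.cong) auto
    then show "(\<Sum>j<b \<phi> xs. F \<phi> xs j) =
      (real (\<Sum>j<b \<phi> xs. x \<phi> (j # xs) * (D \<phi> xs div Suc (z \<phi> (j # xs)))) -
       real (\<Sum>j<b \<phi> xs. y \<phi> (j # xs) * (D \<phi> xs div Suc (z \<phi> (j # xs))))) / real (Suc (D \<phi> xs - 1))"
      using *(4)[of "_ # xs"] pos xs
      by (simp add: Suc_diff_1 diff_divide_distrib sum_subtractf del: of_nat_sum of_nat_Suc)
  qed
qed


section \<open>Unbounded search\<close>

text \<open>Projections of decidable relations are enumerable, by unbounded search for the witness.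
  \<open>Mu\<close> puts the search variable in front, so the witness is
  \<open>xs ! 0\<close>.\<close>

lemma ce_rel_ex:
  assumes "decidable 3 (\<lambda>\<phi> xs. Q (xs ! 1) (xs ! 2) (xs ! 0))"
  shows "ce_rel (\<lambda>n k. \<exists>w. Q n k w)"
proof -
  have "computable 3 (\<lambda>\<phi> xs. of_bool (\<not> Q (xs ! 1) (xs ! 2) (xs ! 0)))"
    by (intro computable_intros assms)
  then obtain p where p: "\<And>\<phi> xs. length xs = 3 \<Longrightarrow>
      computes \<phi> p xs (of_bool (\<not> Q (xs ! 1) (xs ! 2) (xs ! 0)))"
    unfolding computable_def by blast
  have p': "computes \<phi> p [w, n, k] (of_bool (\<not> Q n k w))" for \<phi> w n k
    using p[of "[w, n, k]" \<phi>] by simp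
  have "(\<exists>w. Q n k w) = (\<exists>y. computes (\<lambda>_. 0) (Mu p) [n, k] y)" for n k
  proof
    assume "\<exists>w. Q n k w"
    then obtain w where w: "Q n k w" "\<And>m. m < w \<Longrightarrow> \<not> Q n k m"
      by (metis exists_least_iff)
    have "computes (\<lambda>_. 0) (Mu p) [n, k] w"
    proof (rule computes.mu)
      show "computes (\<lambda>_. 0) p [w, n, k] 0" using p'[where w = w and n = n and k = k] w by simp
      show "\<exists>y. computes (\<lambda>_. 0) p [m, n, k] (Suc y)" if "m < w" for m
        using p'[where w = m and n = n and k = k] w(2)[OF that] by auto
    qed
    then show "\<exists>y. computes (\<lambda>_. 0) (Mu p) [n, k] y" ..
  next
    assume "\<exists>y. computes (\<lambda>_. 0) (Mu p) [n, k] y"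
    then obtain w where "computes (\<lambda>_. 0) p [w, n, k] 0"
      by (auto elim: computes_MuE)
    then have "of_bool (\<not> Q n k w) = (0::nat)"
      using computes_deterministic p' by blast
    then show "\<exists>w. Q n k w" by auto
  qed
  then show ?thesis unfolding ce_rel_def by blast
qed

text \<open>\<open>Mu\<close> finds the least witness and \<open>F\<close> turns it into the answer.
  Requiring all witnesses to yield the same \<open>y\<close> removes any dependence on which one is
  found. The conditions concern one oracle and one input, so the program may diverge
  elsewhere.\<close>

lemma computes_search:
  assumes "decidable (Suc n) (\<lambda>\<phi> l. Q \<phi> (tl l) (hd l))"
    and "computable (Suc n) (\<lambda>\<phi> l. F \<phi> (tl l) (hd l))"
  obtains p where "\<And>\<phi> xs y. length xs = n \<Longrightarrow> \<exists>w. Q \<phi> xs w \<Longrightarrow>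
    (\<And>w. Q \<phi> xs w \<Longrightarrow> F \<phi> xs w = y) \<Longrightarrow> computes \<phi> p xs y"
proof -
  have "computable (Suc n) (\<lambda>\<phi> l. of_bool (\<not> Q \<phi> (tl l) (hd l)))"
    by (intro computable_intros assms)
  then obtain q where "\<And>\<phi> xs. length xs = Suc n \<Longrightarrow>
      computes \<phi> q xs (of_bool (\<not> Q \<phi> (tl xs) (hd xs)))"
    unfolding computable_def by blast
  from this[of "_ # _"] have q: "computes \<phi> q (w # xs) (of_bool (\<not> Q \<phi> xs w))"
    if "length xs = n" for \<phi> xs w using that by simp
  obtain f where "\<And>\<phi> xs. length xs = Suc n \<Longrightarrow> computes \<phi> f xs (F \<phi> (tl xs) (hd xs))"
    using assms(2) unfolding computable_def by blast
  from this[of "_ # _"] have f: "computes \<phi> f (w # xs) (F \<phi> xs w)"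
    if "length xs = n" for \<phi> xs w using that by simp
  show ?thesis
  proof (rule that)
    fix \<phi> xs y assume xs: "length xs = n" and ex: "\<exists>w. Q \<phi> xs w"
      and y: "\<And>w. Q \<phi> xs w \<Longrightarrow> F \<phi> xs w = y"
    from ex obtain w where w: "Q \<phi> xs w" "\<And>m. m < w \<Longrightarrow> \<not> Q \<phi> xs m"
      by (metis exists_least_iff)
    have "computes \<phi> (Mu q) xs w"
    proof (rule computes.mu)
      show "computes \<phi> q (w # xs) 0" using q[OF xs, of \<phi> w] w by simp
      show "\<exists>y. computes \<phi> q (m # xs) (Suc y)" if "m < w" for m
        using q[OF xs, of \<phi> m] w(2)[OF that] by auto
    qed
    then have "computes \<phi> (Comp f (Mu q # map Proj [0..<n])) xs (F \<phi> xs w)"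
      by (intro computes.comp[where ys = "w # xs"] f[OF xs])
        (auto simp: list_all2_conv_all_nth xs nth_Cons' intro: computes.proj)
    then show "computes \<phi> (Comp f (Mu q # map Proj [0..<n])) xs y"
      using y[OF w(1)] by simp
  qed
qed


section \<open>Polygonal approximation of paths\<close>

lemma polygon_code_eq:
  "polygon_code c t = (\<Sum>j<length (list_decode c). rat_code (code_nth c j) *
    max 0 (1 - \<bar>real (length (list_decode c) - 1) * t - real j\<bar>))"
  by (simp add: polygon_code_def polygon_def list_decode_nth)

text \<open>A crude but computable Lipschitz constant: each hat function has slope at most
  \<open>length - 1\<close>, and it is weighted by the modulus of its coefficient.\<close>

definition slope_bound :: "nat \<Rightarrow> real" where
  "slope_bound c = real (length (list_decode c) - 1) * (\<Sum>j<length (list_decode c). \<bar>rat_code (code_nth c j)\<bar>)"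

lemma slope_bound_nonneg: "0 \<le> slope_bound c"
  by (simp add: slope_bound_def sum_nonneg)

lemma polygon_code_lipschitz:
  "\<bar>polygon_code c s - polygon_code c t\<bar> \<le> slope_bound c * \<bar>s - t\<bar>"
proof -
  define m where "m = real (length (list_decode c) - 1)"
  have hat: "\<bar>max 0 (1 - \<bar>m * s - j\<bar>) - max 0 (1 - \<bar>m * t - j\<bar>)\<bar> \<le> m * \<bar>s - t\<bar>" for j
  proof -
    have "\<bar>max 0 (1 - \<bar>m * s - j\<bar>) - max 0 (1 - \<bar>m * t - j\<bar>)\<bar> \<le> \<bar>m * s - m * t\<bar>"
      by (auto simp: max_def abs_if)
    also have "\<dots> = m * \<bar>s - t\<bar>"
      by (simp add: m_def abs_mult flip: right_diff_distrib)
    finally show ?thesis .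
  qed
  have "\<bar>polygon_code c s - polygon_code c t\<bar> = \<bar>\<Sum>j<length (list_decode c). rat_code (code_nth c j) *
      (max 0 (1 - \<bar>m * s - real j\<bar>) - max 0 (1 - \<bar>m * t - real j\<bar>))\<bar>"
    by (simp add: polygon_code_eq m_def right_diff_distrib sum_subtractf)
  also have "\<dots> \<le> (\<Sum>j<length (list_decode c). \<bar>rat_code (code_nth c j)\<bar> * (m * \<bar>s - t\<bar>))"
    by (intro order_trans[OF sum_abs] sum_mono) (auto simp: abs_mult intro!: mult_left_mono hat)
  also have "\<dots> = slope_bound c * \<bar>s - t\<bar>"
    unfolding slope_bound_def m_def[symmetric] sum_distrib_right[symmetric] by simp
  finally show ?thesis .
qed

lemma continuous_on_polygon: "continuous_on S (polygon qs)"
  unfolding polygon_def by (intro continuous_intros)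

lemma continuous_on_polygon_code: "continuous_on S (polygon_code c)"
  unfolding polygon_code_def by (rule continuous_on_polygon)

lemma paths_continuous: "B \<in> paths \<Longrightarrow> continuous_on {0..} B"
  by (simp add: paths_eq)

lemma continuous_on_piece:
  assumes "B \<in> paths" shows "continuous_on {0..1} (piece B i)"
proof -
  have "continuous_on {0..1} (\<lambda>t. B (real i + t))"
    by (rule continuous_on_compose2[OF paths_continuous[OF assms]]) (auto intro!: continuous_intros)
  then show ?thesis
    by (cases "i = 0") (auto simp: piece_def[abs_def] intro!: continuous_intros)
qed

lemma abs_diff_le_uniform_dist:
  assumes "continuous_on {0..1} f" "continuous_on {0..1} g" "t \<in> {0..1}"
  shows "\<bar>f t - g t\<bar> \<le> uniform_dist f g"
proof -
  have "compact ((\<lambda>t. \<bar>f t - g t\<bar>) ` {0..1})"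
    by (intro compact_continuous_image continuous_intros assms) simp
  then have "bdd_above ((\<lambda>t. \<bar>f t - g t\<bar>) ` {0..1})"
    by (simp add: compact_imp_bounded bounded_imp_bdd_above)
  then show ?thesis
    unfolding uniform_dist_def by (rule cSUP_upper2) (use assms in auto)
qed

lemma uniform_dist_le:
  assumes "\<And>t. t \<in> {0..1} \<Longrightarrow> \<bar>f t - g t\<bar> \<le> d" shows "uniform_dist f g \<le> d"
  unfolding uniform_dist_def by (rule cSUP_least) (use assms in auto)

lemma path_eq_sum_pieces: "B (real i + t) = (\<Sum>m<i. piece B m 1) + piece B i t"
proof -
  have "(\<Sum>m<i. piece B m 1) = (if i = 0 then 0 else B (real i))"
    by (induction i) (auto simp: piece_def add.commute)
  then show ?thesis by (simp add: piece_def)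
qed

text \<open>The pieces are increments, so the value at \<open>i + t\<close> needs the end values of
  all earlier pieces. This is why the error below grows with the number of pieces.\<close>

definition approx :: "(nat \<Rightarrow> nat) \<Rightarrow> nat \<Rightarrow> real \<Rightarrow> real" where
  "approx c i t = (\<Sum>m<i. polygon_code (c m) 1) + polygon_code (c i) t"

definition approximates :: "(nat \<Rightarrow> nat) \<Rightarrow> (real \<Rightarrow> real) \<Rightarrow> nat \<Rightarrow> real \<Rightarrow> bool" where
  "approximates c B L \<epsilon> \<longleftrightarrow> (\<forall>i<L. uniform_dist (piece B i) (polygon_code (c i)) \<le> \<epsilon>)"

lemma approx_error:
  assumes B: "B \<in> paths" and c: "approximates c B L \<epsilon>" and i: "i < L" and t: "t \<in> {0..1}"
  shows "\<bar>B (real i + t) - approx c i t\<bar> \<le> real L * \<epsilon>"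
proof -
  have piece: "\<bar>piece B m u - polygon_code (c m) u\<bar> \<le> \<epsilon>" if "m < L" "u \<in> {0..1}" for m u
    using abs_diff_le_uniform_dist[OF continuous_on_piece[OF B] continuous_on_polygon_code that(2), of m "c m"]
      c that(1) by (force simp: approximates_def)
  have "\<bar>B (real i + t) - approx c i t\<bar> =
      \<bar>(\<Sum>m<i. piece B m 1 - polygon_code (c m) 1) + (piece B i t - polygon_code (c i) t)\<bar>"
    by (simp add: path_eq_sum_pieces approx_def sum_subtractf)
  also have "\<dots> \<le> (\<Sum>m<i. \<bar>piece B m 1 - polygon_code (c m) 1\<bar>) + \<bar>piece B i t - polygon_code (c i) t\<bar>"
    by (intro order_trans[OF abs_triangle_ineq] add_mono sum_abs order_refl)
  also have "\<dots> \<le> (\<Sum>m<i. \<epsilon>) + \<epsilon>"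
    using i t by (intro add_mono sum_mono piece) auto
  also have "\<dots> = real (Suc i) * \<epsilon>"
    by (simp add: algebra_simps)
  \<comment> \<open>\<open>0 \<le> \<epsilon>\<close> comes from the piece bound itself, which
    dominates an absolute value.\<close>
  also have "\<dots> \<le> real L * \<epsilon>"
    using i piece[OF i t] by (intro mult_right_mono) auto
  finally show ?thesis .
qed

lemma approx_lipschitz: "\<bar>approx c i s - approx c i t\<bar> \<le> slope_bound (c i) * \<bar>s - t\<bar>"
  using polygon_code_lipschitz[of "c i" s t] by (simp add: approx_def)

text \<open>For \<open>x\<close> between \<open>k\<close> and \<open>k + 1\<close> only the hats at
  these two nodes are nonzero, with values \<open>k + 1 - x\<close> and
  \<open>x - k\<close>.\<close>

lemma hat_functions_sum:
  fixes x :: real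
  assumes "m \<ge> 1" "0 \<le> x" "x \<le> real m"
  shows "(\<Sum>j<Suc m. max 0 (1 - \<bar>x - real j\<bar>)) = 1"
proof -
  obtain k where k: "k < m" "real k \<le> x" "x \<le> real (Suc k)"
  proof (cases "x = real m")
    \<comment> \<open>The right end belongs to the last cell; the floor would give \<open>m\<close>,
      beyond the cells.\<close>
    case True
    then show ?thesis using assms by (intro that[of "m - 1"]) (auto simp: of_nat_diff)
  next
    case False
    then show ?thesis using assms by (intro that[of "nat \<lfloor>x\<rfloor>"]) (linarith, linarith, linarith)
  qed
  have "(\<Sum>j<Suc m. max 0 (1 - \<bar>x - real j\<bar>)) = (\<Sum>j\<in>{k, Suc k}. max 0 (1 - \<bar>x - real j\<bar>))"
  proof (rule sum.mono_neutral_right)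
    show "\<forall>j\<in>{..<Suc m} - {k, Suc k}. max 0 (1 - \<bar>x - real j\<bar>) = 0"
    proof
      fix j assume "j \<in> {..<Suc m} - {k, Suc k}"
      then have "Suc j \<le> k \<or> Suc (Suc k) \<le> j" by auto
      then have "real j + 1 \<le> real k \<or> real k + 2 \<le> real j" by linarith
      then show "max 0 (1 - \<bar>x - real j\<bar>) = 0" using k by (auto simp: max_def abs_if)
    qed
  qed (use k in auto)
  also have "\<dots> = 1" using k by (simp add: max_def abs_if)
  finally show ?thesis .
qed

text \<open>Since the hats sum to 1, the error at \<open>t\<close> is a weighted average of
  \<open>f t - rat_code (g j)\<close> over nodes within \<open>1/m\<close> of \<open>t\<close>. Half
  of \<open>d\<close> pays for the oscillation of \<open>f\<close>, half for rounding its values to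
  rationals.\<close>

lemma ex_polygon_code:
  assumes f: "continuous_on {0..1} f" and d: "d > 0"
  obtains c where "uniform_dist f (polygon_code c) \<le> d"
proof -
  have "uniformly_continuous_on {0..1} f"
    using f by (simp add: compact_uniformly_continuous)
  then obtain e where e: "e > 0"
    "\<And>s t. s \<in> {0..1} \<Longrightarrow> t \<in> {0..1} \<Longrightarrow> \<bar>s - t\<bar> < e \<Longrightarrow> \<bar>f s - f t\<bar> < d / 2"
    using d unfolding uniformly_continuous_on_def dist_real_def
    by (metis half_gt_zero_iff abs_minus_commute)
  obtain m' where m': "1 / real (Suc m') < e"
    using e(1) reals_Archimedean[of e] by (auto simp: inverse_eq_divide)
  define m where "m = Suc m'"
  have m: "m \<ge> 1" "1 / real m < e" using m' by (auto simp: m_def)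
  have "\<exists>c. \<bar>rat_code c - f (real j / real m)\<bar> < d / 2" for j
  proof -
    obtain q where "q \<in> \<rat>" "f (real j / real m) - d / 2 < q" "q < f (real j / real m)"
      using Rats_dense_in_real[of "f (real j / real m) - d / 2" "f (real j / real m)"] d by auto
    moreover from this obtain c where "rat_code c = q" using rat_code_surj by blast
    ultimately have "\<bar>rat_code c - f (real j / real m)\<bar> < d / 2" using d by (auto simp: abs_if)
    then show ?thesis ..
  qed
  then obtain g where g: "\<And>j. \<bar>rat_code (g j) - f (real j / real m)\<bar> < d / 2" by metis
  define c where "c = list_encode (map g [0..<Suc m])"
  define h where "h t j = max 0 (1 - \<bar>real m * t - real j\<bar>)" for t j
  have pc: "polygon_code c t = (\<Sum>j<Suc m. rat_code (g j) * h t j)" for t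
    unfolding polygon_code_def polygon_def c_def h_def list_encode_inverse
    by (intro sum.cong) (simp_all add: nth_append del: upt_Suc)
  have "\<bar>f t - polygon_code c t\<bar> \<le> d" if t: "t \<in> {0..1}" for t
  proof -
    have sum1: "(\<Sum>j<Suc m. h t j) = 1"
      unfolding h_def using t m by (intro hat_functions_sum) (auto simp: mult_left_le)
    have "\<bar>f t - polygon_code c t\<bar> = \<bar>(\<Sum>j<Suc m. f t * h t j) - (\<Sum>j<Suc m. rat_code (g j) * h t j)\<bar>"
      unfolding pc sum_distrib_left[symmetric] sum1 by simp
    also have "\<dots> \<le> (\<Sum>j<Suc m. \<bar>f t - rat_code (g j)\<bar> * h t j)"
      unfolding sum_subtractf[symmetric] left_diff_distrib[symmetric]
      by (intro order_trans[OF sum_abs] sum_mono) (simp add: abs_mult h_def)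
    also have "\<dots> \<le> (\<Sum>j<Suc m. d * h t j)"
    proof (rule sum_mono)
      fix j assume j: "j \<in> {..<Suc m}"
      show "\<bar>f t - rat_code (g j)\<bar> * h t j \<le> d * h t j"
      proof (cases "h t j = 0")
        case False
        then have "\<bar>real m * t - real j\<bar> < 1" by (auto simp: h_def max_def split: if_splits)
        moreover have "real m * t - real j = real m * (t - real j / real m)"
          using m by (simp add: field_simps)
        ultimately have "real m * \<bar>t - real j / real m\<bar> < 1"
          by (simp add: abs_mult)
        then have "\<bar>t - real j / real m\<bar> < 1 / real m"
          using m by (simp add: field_simps)
        then have "\<bar>f t - f (real j / real m)\<bar> < d / 2"
          using t j m by (intro e) auto
        then have "\<bar>f t - rat_code (g j)\<bar> \<le> d" using g[of j] by linarith
        then show ?thesis by (rule mult_right_mono) (simp add: h_def)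
      qed simp
    qed
    also have "\<dots> = d" unfolding sum_distrib_left[symmetric] sum1 by simp
    finally show ?thesis .
  qed
  then show ?thesis by (intro that uniform_dist_le) auto
qed

lemma ex_path_name:
  assumes "B \<in> paths" obtains \<phi> where "path_name \<phi> B"
proof -
  have "\<exists>c. uniform_dist (piece B i) (polygon_code c) \<le> (1/2) ^ k" for i k
    using ex_polygon_code[OF continuous_on_piece[OF assms], of "(1/2) ^ k"] by (metis zero_less_divide_1_iff zero_less_numeral zero_less_power)
  then obtain g where g: "\<And>i k. uniform_dist (piece B i) (polygon_code (g i k)) \<le> (1/2) ^ k"
    by metis
  show ?thesis
    by (rule that[of "\<lambda>e. case prod_decode e of (i, k) \<Rightarrow> g i k"]) (simp add: path_name_def g)
qed

lemma path_name_approximates: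
  "path_name \<phi> B \<Longrightarrow> approximates (\<lambda>i. \<phi> (prod_encode (i, s))) B L ((1/2) ^ s)"
  by (simp add: path_name_def approximates_def)


section \<open>Certificates on grids\<close>

text \<open>
  A cell is an interval between consecutive multiples of \<open>1/(N+1)\<close>. The slope bound carries the
  inequality from the left end of a cell to all of it, so finitely many evaluations at rational
  points suffice.
\<close>

definition lower_cert ::
    "(nat \<Rightarrow> nat) \<Rightarrow> nat \<Rightarrow> nat \<Rightarrow> real \<Rightarrow> real \<Rightarrow> real \<Rightarrow> real \<Rightarrow> bool" where
  "lower_cert c L N a b \<theta> \<sigma> \<longleftrightarrow> (\<forall>i<L. \<forall>j<Suc N.
     real i + real j / real (Suc N) \<le> b \<and> a \<le> real i + real (Suc j) / real (Suc N) \<longrightarrow>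
     \<theta> + slope_bound (c i) / real (Suc N) < \<sigma> * approx c i (real j / real (Suc N)))"

text \<open>One sampled value witnesses this condition, so no slope term enters.\<close>

definition point_cert ::
    "(nat \<Rightarrow> nat) \<Rightarrow> nat \<Rightarrow> nat \<Rightarrow> real \<Rightarrow> real \<Rightarrow> real \<Rightarrow> real \<Rightarrow> bool" where
  "point_cert c L N a b \<theta> \<sigma> \<longleftrightarrow> (\<exists>i<L. \<exists>j<Suc N.
     a < real i + real j / real (Suc N) \<and> real i + real j / real (Suc N) < b \<and>
     \<sigma> * approx c i (real j / real (Suc N)) < \<theta>)"

lemma ex_cell:
  fixes t :: real
  assumes "0 \<le> t" "t < real L"
  obtains i j where "i < L" "j < Suc N" "real i + real j / real (Suc N) \<le> t"
    "t < real i + real (Suc j) / real (Suc N)"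
proof -
  define i where "i = nat \<lfloor>t\<rfloor>"
  define j where "j = nat \<lfloor>(t - real i) * real (Suc N)\<rfloor>"
  have i: "real i \<le> t" "t < real i + 1" unfolding i_def using assms by linarith+
  have "0 \<le> (t - real i) * real (Suc N)" using i by simp
  then have j: "real j \<le> (t - real i) * real (Suc N)" "(t - real i) * real (Suc N) < real (Suc j)"
    unfolding j_def by linarith+
  have "(t - real i) * real (Suc N) < 1 * real (Suc N)"
    using i by (intro mult_strict_right_mono) auto
  then have "real j < real (Suc N)" using order.strict_trans1[OF j(1)] by simp
  then have "j < Suc N" by simp
  moreover have "i < L" using i assms by linarith
  moreover have "real j / real (Suc N) \<le> t - real i" "t - real i < real (Suc j) / real (Suc N)"
    using j by (simp_all add: pos_divide_le_eq pos_less_divide_eq del: of_nat_Suc)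
  ultimately show ?thesis by (intro that[of i j]) auto
qed

lemma grid_mem: "j < Suc N \<Longrightarrow> real j / real (Suc N) \<in> {0..1}"
  by (simp add: divide_le_eq)

text \<open>Moving from the left end of the cell to \<open>t\<close> costs the slope term, already
  part of the certificate; replacing \<open>approx\<close> by \<open>B\<close> costs the
  \<open>L * \<epsilon>\<close> left in the conclusion.\<close>

lemma lower_cert_sound:
  assumes B: "B \<in> paths" and c: "approximates c B L \<epsilon>" and cert: "lower_cert c L N a b \<theta> \<sigma>"
    and \<sigma>: "\<bar>\<sigma>\<bar> = 1" and "0 \<le> a" "b < real L" and t: "t \<in> {a..b}"
  shows "\<theta> - real L * \<epsilon> < \<sigma> * B t"
proof -
  have "0 \<le> t" "t < real L" using assms by auto
  then obtain i j where ij: "i < L" "j < Suc N" "real i + real j / real (Suc N) \<le> t"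
    "t < real i + real (Suc j) / real (Suc N)" by (rule ex_cell)
  let ?u = "real j / real (Suc N)" and ?s = "t - real i"
  have "real (Suc j) / real (Suc N) \<le> 1" using ij(2) by (simp add: divide_le_eq)
  moreover have "0 \<le> ?u" by simp
  ultimately have s: "?s \<in> {0..1}"
    using ij(3,4) unfolding atLeastAtMost_iff by linarith
  have "\<bar>?s - ?u\<bar> \<le> 1 / real (Suc N)"
    using ij(3,4) by (auto simp: add_divide_distrib)
  then have "\<bar>approx c i ?s - approx c i ?u\<bar> \<le> slope_bound (c i) * (1 / real (Suc N))"
    by (intro order_trans[OF approx_lipschitz] mult_left_mono slope_bound_nonneg)
  moreover have "\<bar>B t - approx c i ?s\<bar> \<le> real L * \<epsilon>"
    using approx_error[OF B c ij(1) s] by simp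
  moreover have "\<theta> + slope_bound (c i) / real (Suc N) < \<sigma> * approx c i ?u"
    using cert ij t unfolding lower_cert_def by auto
  moreover have "\<sigma> = 1 \<or> \<sigma> = -1" using \<sigma> by auto
  ultimately show ?thesis by (auto simp: abs_le_iff)
qed

lemma point_cert_sound:
  assumes B: "B \<in> paths" and c: "approximates c B L \<epsilon>" and cert: "point_cert c L N a b \<theta> \<sigma>"
    and \<sigma>: "\<bar>\<sigma>\<bar> = 1"
  obtains t where "t \<in> {a<..<b}" "0 \<le> t" "\<sigma> * B t < \<theta> + real L * \<epsilon>"
proof -
  from cert obtain i j where ij: "i < L" "j < Suc N" "a < real i + real j / real (Suc N)"
    "real i + real j / real (Suc N) < b" "\<sigma> * approx c i (real j / real (Suc N)) < \<theta>"
    unfolding point_cert_def by blast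
  have "\<sigma> = 1 \<or> \<sigma> = -1" using \<sigma> by auto
  then have "\<sigma> * B (real i + real j / real (Suc N)) < \<theta> + real L * \<epsilon>"
    using approx_error[OF B c ij(1) grid_mem[OF ij(2)]] ij(5) by (auto simp: abs_le_iff)
  then show ?thesis using ij by (intro that) auto
qed

text \<open>One \<open>L * \<epsilon>\<close> pays for the raised threshold that soundness will
  consume, the other for the error of \<open>approx\<close>. The slack \<open>\<gamma>\<close>
  covers the slope term twice: in the certificate, and for moving from a point of
  \<open>[a, b]\<close> to the left end of the cell.\<close>

lemma lower_cert_complete:
  assumes B: "B \<in> paths" and c: "approximates c B L \<epsilon>" and "\<bar>\<sigma>\<bar> = 1"
    and ab: "0 \<le> a" "a \<le> b" and lower: "\<And>t. t \<in> {a..b} \<Longrightarrow> \<theta> + 2 * real L * \<epsilon> + \<gamma> \<le> \<sigma> * B t"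
    and "\<gamma> > 0"
  shows "\<forall>\<^sub>F N in sequentially. lower_cert c L N a b (\<theta> + real L * \<epsilon>) \<sigma>"
proof -
  have "(\<lambda>N. 2 * slope_bound (c i) / real (Suc N)) \<longlonglongrightarrow> 0" for i
    by (rule real_tendsto_divide_at_top[OF tendsto_const
          filterlim_compose[OF filterlim_real_sequentially filterlim_Suc]])
  then have "\<forall>\<^sub>F N in sequentially. 2 * slope_bound (c i) / real (Suc N) < \<gamma>" for i
    using \<open>\<gamma> > 0\<close> by (rule order_tendstoD)
  then have "\<forall>\<^sub>F N in sequentially. \<forall>i\<in>{..<L}. 2 * slope_bound (c i) / real (Suc N) < \<gamma>"
    by (intro eventually_ball_finite) auto
  then show ?thesis
  proof eventually_elim
    case (elim N)
    show ?case unfolding lower_cert_def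
    proof (intro allI impI)
      fix i j assume i: "i < L" and j: "j < Suc N"
        and cell: "real i + real j / real (Suc N) \<le> b \<and> a \<le> real i + real (Suc j) / real (Suc N)"
      let ?u = "real j / real (Suc N)" and ?v = "real (Suc j) / real (Suc N)"
      \<comment> \<open>The cell meeting \<open>[a, b]\<close> may begin before \<open>a\<close>,
        where nothing is assumed about \<open>B\<close>; \<open>t\<close> is the first point of the
        cell that lies in \<open>[a, b]\<close>.\<close>
      define t where "t = max a (real i + ?u)"
      have v: "?v = ?u + 1 / real (Suc N)" by (simp add: add_divide_distrib)
      have "?v \<le> 1" using j by (simp add: divide_le_eq)
      then have s: "t - real i \<in> {0..1}" "t \<in> {a..b}" "\<bar>t - real i - ?u\<bar> \<le> 1 / real (Suc N)"
      proof -
        have aux: "max a (x + u) - x \<in> {0..1} \<and> max a (x + u) \<in> {a..b} \<and> \<bar>max a (x + u) - x - u\<bar> \<le> h"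
          if "0 \<le> u" "0 \<le> h" "u + h \<le> 1" "x + u \<le> b" "a \<le> x + (u + h)" "a \<le> b" for x u h :: real
          using that by (auto simp: max_def)
        have "0 \<le> ?u" "0 \<le> 1 / real (Suc N)" by simp_all
        from aux[OF this, of "real i"] \<open>?v \<le> 1\<close> cell ab(2)
        show "t - real i \<in> {0..1}" "t \<in> {a..b}" "\<bar>t - real i - ?u\<bar> \<le> 1 / real (Suc N)"
          unfolding v t_def by blast+
      qed
      have "\<bar>approx c i (t - real i) - approx c i ?u\<bar> \<le> slope_bound (c i) * (1 / real (Suc N))"
        using s(3) by (intro order_trans[OF approx_lipschitz] mult_left_mono slope_bound_nonneg)
      moreover have "\<bar>B t - approx c i (t - real i)\<bar> \<le> real L * \<epsilon>"
        using approx_error[OF B c i s(1)] by simp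
      moreover have "2 * (slope_bound (c i) / real (Suc N)) < \<gamma>"
        using elim i by auto
      moreover have "\<sigma> = 1 \<or> \<sigma> = -1" using \<open>\<bar>\<sigma>\<bar> = 1\<close> by auto
      ultimately show "\<theta> + real L * \<epsilon> + slope_bound (c i) / real (Suc N) < \<sigma> * approx c i ?u"
        using lower[OF s(2)] by (auto simp: abs_le_iff)
    qed
  qed
qed

lemma point_cert_complete:
  assumes B: "B \<in> paths" and c: "approximates c B L \<epsilon>" and \<sigma>: "\<bar>\<sigma>\<bar> = 1"
    and t: "0 \<le> t" "t \<in> {a<..<b}" "t < real L" and upper: "\<sigma> * B t < \<theta> - 2 * real L * \<epsilon>"
  shows "\<forall>\<^sub>F N in sequentially. point_cert c L N a b (\<theta> - real L * \<epsilon>) \<sigma>"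
proof -
  have "continuous_on {0..} (\<lambda>t. \<sigma> * B t)"
    by (intro continuous_intros paths_continuous B)
  moreover have "\<theta> - 2 * real L * \<epsilon> - \<sigma> * B t > 0" using upper by simp
  ultimately obtain d where d: "d > 0" "\<And>s. s \<ge> 0 \<Longrightarrow> \<bar>s - t\<bar> < d \<Longrightarrow>
      \<bar>\<sigma> * B s - \<sigma> * B t\<bar> < \<theta> - 2 * real L * \<epsilon> - \<sigma> * B t"
    using t(1) unfolding continuous_on_iff dist_real_def by (metis atLeast_iff)
  have "(\<lambda>N. 1 / real (Suc N)) \<longlonglongrightarrow> 0"
    by (rule real_tendsto_divide_at_top[OF tendsto_const
          filterlim_compose[OF filterlim_real_sequentially filterlim_Suc]])
  \<comment> \<open>The left end of the cell around \<open>t\<close> serves as the sample: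
    \<open>d\<close> keeps the value small there, and \<open>t - a\<close> keeps the point above
    \<open>a\<close>.\<close>
  then have "\<forall>\<^sub>F N in sequentially. 1 / real (Suc N) < min d (t - a)"
    by (rule order_tendstoD) (use d t in auto)
  then show ?thesis
  proof eventually_elim
    case (elim N)
    obtain i j where ij: "i < L" "j < Suc N" "real i + real j / real (Suc N) \<le> t"
      "t < real i + real (Suc j) / real (Suc N)" using ex_cell[OF t(1,3)] .
    let ?s = "real i + real j / real (Suc N)"
    have "t < ?s + 1 / real (Suc N)" using ij(4) by (simp add: add_divide_distrib)
    then have s: "a < ?s" "?s < b" "\<bar>?s - t\<bar> < d" using elim ij(3) t by auto
    have "\<sigma> * B ?s < \<theta> - 2 * real L * \<epsilon>" using d(2)[OF _ s(3)] by auto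
    moreover have "\<bar>B ?s - approx c i (real j / real (Suc N))\<bar> \<le> real L * \<epsilon>"
      using approx_error[OF B c ij(1) grid_mem[OF ij(2)]] .
    moreover have "\<sigma> = 1 \<or> \<sigma> = -1" using \<sigma> by auto
    ultimately have "\<sigma> * approx c i (real j / real (Suc N)) < \<theta> - real L * \<epsilon>"
      by (auto simp: abs_le_iff)
    then show ?case using ij s unfolding point_cert_def by blast
  qed
qed


section \<open>Decidability of the certificates\<close>

lemma computable_polygon_code [computable_intros]:
  assumes "computable n c" "computable_rat n t"
  shows "computable_rat n (\<lambda>\<phi> xs. polygon_code (c \<phi> xs) (t \<phi> xs))"
proof -
  have [computable_intros]: "computable_rat m (\<lambda>_ _. 1)" for m by (intro computable_intros) simp
  show ?thesis unfolding polygon_code_eq by (intro computable_intros assms)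
qed

lemma computable_slope_bound [computable_intros]:
  assumes "computable n c"
  shows "computable_rat n (\<lambda>\<phi> xs. slope_bound (c \<phi> xs))"
  unfolding slope_bound_def by (intro computable_intros assms)

lemma computable_approx [computable_intros]:
  assumes "computable (Suc n) (\<lambda>\<phi> l. C \<phi> (tl l) (hd l))" "computable n i" "computable_rat n t"
  shows "computable_rat n (\<lambda>\<phi> xs. approx (C \<phi> xs) (i \<phi> xs) (t \<phi> xs))"
proof -
  have [computable_intros]: "computable_rat m (\<lambda>_ _. 1)" for m by (intro computable_intros) simp
  show ?thesis unfolding approx_def by (intro computable_intros assms computable_Let[OF assms(1)])
qed

lemma decidable_lower_cert [computable_intros]:
  assumes C: "computable (Suc n) (\<lambda>\<phi> l. C \<phi> (tl l) (hd l))" and "computable n L" "computable n N"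
    "computable_rat n a" "computable_rat n b" "computable_rat n \<theta>" "\<sigma> \<in> \<rat>"
  shows "decidable n (\<lambda>\<phi> xs. lower_cert (C \<phi> xs) (L \<phi> xs) (N \<phi> xs) (a \<phi> xs) (b \<phi> xs) (\<theta> \<phi> xs) \<sigma>)"
proof -
  \<comment> \<open>The centre function binds its own index, which has to be moved past one more
    list entry under each of the two quantifiers.\<close>
  note C2 = computable_drop_second[OF C]
  note C3 = computable_drop_second[OF C2]
  show ?thesis unfolding lower_cert_def
    by (intro computable_intros assms C2 C3 computable_Let[OF C2])
qed

lemma decidable_point_cert [computable_intros]:
  assumes C: "computable (Suc n) (\<lambda>\<phi> l. C \<phi> (tl l) (hd l))" and "computable n L" "computable n N"
    "computable_rat n a" "computable_rat n b" "computable_rat n \<theta>" "\<sigma> \<in> \<rat>"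
  shows "decidable n (\<lambda>\<phi> xs. point_cert (C \<phi> xs) (L \<phi> xs) (N \<phi> xs) (a \<phi> xs) (b \<phi> xs) (\<theta> \<phi> xs) \<sigma>)"
proof -
  note C2 = computable_drop_second[OF C]
  note C3 = computable_drop_second[OF C2]
  show ?thesis unfolding point_cert_def
    by (intro computable_intros assms C2 C3 computable_Let[OF C2])
qed


section \<open>Gaussian estimates\<close>

text \<open>The peak \<open>1 / sqrt (2 * pi * s^2)\<close> is at most \<open>1 / (2 * s)\<close>
  because \<open>pi \<ge> 2\<close>.\<close>

lemma normal_density_0_le: "0 < s \<Longrightarrow> normal_density 0 s x \<le> 1 / (2 * s)"
proof -
  assume s: "0 < s"
  have "(2 * s)\<^sup>2 \<le> 2 * pi * s\<^sup>2"
    using pi_ge_two by (simp add: power_mult_distrib mult_right_mono)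
  then have "2 * s \<le> sqrt (2 * pi * s\<^sup>2)" by (rule real_le_rsqrt)
  then have "1 / sqrt (2 * pi * s\<^sup>2) * exp (- (x - 0)\<^sup>2 / (2 * s\<^sup>2)) \<le> 1 / (2 * s) * 1"
    using s by (intro mult_mono) (auto simp: divide_simps)
  then show ?thesis by (simp add: normal_density_def)
qed

context prob_space
begin

lemma normal_prob_interval_le:
  assumes X: "distributed M lborel X (normal_density 0 s)" and "0 < s" "c \<le> d"
  shows "prob (X -` {c<..<d} \<inter> space M) \<le> (d - c) / (2 * s)"
proof -
  have "emeasure M (X -` {c<..<d} \<inter> space M) = (\<integral>\<^sup>+x. ennreal (normal_density 0 s x) * indicator {c<..<d} x \<partial>lborel)"
    by (rule distributed_emeasure[OF X]) simp
  also have "\<dots> \<le> (\<integral>\<^sup>+x. ennreal (1 / (2 * s)) * indicator {c<..<d} x \<partial>lborel)"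
    using \<open>0 < s\<close> by (intro nn_integral_mono mult_right_mono ennreal_leI normal_density_0_le) auto
  also have "\<dots> = ennreal (1 / (2 * s)) * ennreal (d - c)"
    using \<open>c \<le> d\<close> by (simp add: nn_integral_cmult_indicator)
  also have "\<dots> = ennreal ((d - c) / (2 * s))"
    using assms by (simp flip: ennreal_mult)
  finally show ?thesis
    using assms by (simp add: emeasure_eq_measure)
qed

text \<open>For each fixed value of \<open>Y\<close>, the variable \<open>X\<close> has to fall into
  an interval of length \<open>2 * \<epsilon>\<close>, whose probability is at most
  \<open>\<epsilon> / s\<close>; Fubini integrates this over the law of \<open>Y\<close>.\<close>

lemma normal_anti_concentration:
  assumes X: "distributed M lborel X (normal_density 0 s)" and s: "0 < s"
    and XY: "indep_var borel X borel Y" and \<epsilon>: "0 \<le> \<epsilon>"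
  shows "prob {x \<in> space M. \<bar>X x + Y x\<bar> < \<epsilon>} \<le> \<epsilon> / s"
proof -
  note rv = indep_var_rv1[OF XY] indep_var_rv2[OF XY]
  interpret X: prob_space "distr M borel X" by (rule prob_space_distr) (rule rv)
  interpret Y: prob_space "distr M borel Y" by (rule prob_space_distr) (rule rv)
  interpret XY: pair_prob_space "distr M borel X" "distr M borel Y" ..
  define S where "S = {p. \<bar>fst p + snd p\<bar> < (\<epsilon>::real)}"
  have S: "S \<in> sets (borel \<Otimes>\<^sub>M borel)"
    unfolding S_def borel_prod
    by (intro borel_open open_Collect_less continuous_intros)
  have section_le: "emeasure (distr M borel X) ((\<lambda>x. (x, y)) -` S) \<le> ennreal (\<epsilon> / s)" for y
  proof -
    have "(\<lambda>x. (x, y)) -` S = {- y - \<epsilon> <..< - y + \<epsilon>}"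
      by (auto simp: S_def)
    moreover have "prob (X -` {- y - \<epsilon> <..< - y + \<epsilon>} \<inter> space M) \<le> \<epsilon> / s"
      using normal_prob_interval_le[OF X s, of "- y - \<epsilon>" "- y + \<epsilon>"] \<epsilon> by simp
    ultimately show ?thesis
      using rv by (simp add: emeasure_distr emeasure_eq_measure ennreal_leI)
  qed
  have "emeasure M {x \<in> space M. \<bar>X x + Y x\<bar> < \<epsilon>} = emeasure (distr M (borel \<Otimes>\<^sub>M borel) (\<lambda>x. (X x, Y x))) S"
    using rv S by (subst emeasure_distr) (auto simp: S_def intro!: arg_cong[where f = "emeasure M"])
  also have "\<dots> = emeasure (distr M borel X \<Otimes>\<^sub>M distr M borel Y) S"
    using XY by (simp add: indep_var_distribution_eq)
  also have "\<dots> = (\<integral>\<^sup>+y. emeasure (distr M borel X) ((\<lambda>x. (x, y)) -` S) \<partial>distr M borel Y)"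
    using S by (intro XY.emeasure_pair_measure_alt2) simp
  also have "\<dots> \<le> (\<integral>\<^sup>+y. ennreal (\<epsilon> / s) \<partial>distr M borel Y)"
    by (intro nn_integral_mono section_le)
  also have "\<dots> = ennreal (\<epsilon> / s)"
    using Y.emeasure_space_1 by simp
  finally show ?thesis
    using \<epsilon> s by (simp add: emeasure_eq_measure)
qed

text \<open>Chebyshev's inequality. Quadratic decay is enough, since \<open>K\<close> will grow
  exponentially with the test level.\<close>

lemma normal_tail_le:
  assumes X: "distributed M lborel X (normal_density 0 s)" and s: "0 < s" and K: "0 < K"
  shows "prob {x \<in> space M. K * s < X x} \<le> 1 / K\<^sup>2"
proof -
  have rv [measurable]: "random_variable borel X"
    using distributed_measurable[OF X] by simp
  have "integrable lborel (\<lambda>x. normal_density 0 s x * x\<^sup>2)"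
    using integrable_normal_moment[OF s, of 0 2] by simp
  then have int: "integrable M (\<lambda>x. (X x)\<^sup>2)"
    by (subst (asm) distributed_integrable[OF X]) auto
  have E: "expectation X = 0" by (rule normal_distributed_expectation[OF s X])
  have "prob {x \<in> space M. K * s < X x} \<le> prob {x \<in> space M. K * s \<le> \<bar>X x - expectation X\<bar>}"
    by (intro finite_measure_mono) (auto simp: E)
  also have "\<dots> \<le> variance X / (K * s)\<^sup>2"
    using K s int by (intro Chebyshev_inequality) auto
  also have "\<dots> = 1 / K\<^sup>2"
    using s K by (simp add: normal_distributed_variance[OF s X] power_mult_distrib)
  finally show ?thesis .
qed

text \<open>Symmetry gives at most \<open>1/2\<close> to the positive half line, and the interval
  from \<open>- c\<close> to 0 has mass at most \<open>c / (2 * s) \<le> 1/4\<close>.\<close>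

lemma normal_greater_le:
  assumes X: "distributed M lborel X (normal_density 0 s)" and s: "0 < s" and c: "0 \<le> c" "2 * c \<le> s"
  shows "prob (X -` {- c<..} \<inter> space M) \<le> 3 / 4"
proof -
  have rv [measurable]: "random_variable borel X"
    using distributed_measurable[OF X] by simp
  have "distributed M lborel (\<lambda>x. 0 + (-1) * X x) (normal_density (0 + (-1) * 0) (\<bar>-1\<bar> * s))"
    by (rule normal_density_affine[OF X s]) simp
  then have X': "distributed M lborel (\<lambda>x. - X x) (normal_density 0 s)" by simp
  have "emeasure M (X -` {0<..} \<inter> space M) = emeasure M ((\<lambda>x. - X x) -` {0<..} \<inter> space M)"
    by (simp add: distributed_emeasure[OF X] distributed_emeasure[OF X'])
  then have "prob (X -` {0<..} \<inter> space M) = prob ((\<lambda>x. - X x) -` {0<..} \<inter> space M)"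
    by (simp add: measure_def)
  moreover have "prob (X -` {0<..} \<inter> space M) + prob ((\<lambda>x. - X x) -` {0<..} \<inter> space M) =
      prob ((X -` {0<..} \<inter> space M) \<union> ((\<lambda>x. - X x) -` {0<..} \<inter> space M))"
    by (rule finite_measure_Union[symmetric]) auto
  ultimately have half: "2 * prob (X -` {0<..} \<inter> space M) \<le> 1"
    using prob_le_1[of "(X -` {0<..} \<inter> space M) \<union> ((\<lambda>x. - X x) -` {0<..} \<inter> space M)"] by linarith
  have zero: "prob (X -` {0} \<inter> space M) = 0"
  proof -
    have "emeasure M (X -` {0} \<inter> space M) = (\<integral>\<^sup>+x. ennreal (normal_density 0 s x) * indicator {0} x \<partial>lborel)"
      by (rule distributed_emeasure[OF X]) simp
    also have "\<dots> = 0"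
      by (subst nn_integral_0_iff_AE) (auto intro!: AE_I'[of "{0::real}"] simp: null_sets_def indicator_def)
    finally show ?thesis by (simp add: measure_def)
  qed
  have "prob (X -` {- c<..} \<inter> space M) \<le>
      prob ((X -` {0<..} \<inter> space M) \<union> (X -` {0} \<inter> space M) \<union> (X -` {- c<..<0} \<inter> space M))"
    by (intro finite_measure_mono) auto
  also have "\<dots> \<le> prob ((X -` {0<..} \<inter> space M) \<union> (X -` {0} \<inter> space M)) + prob (X -` {- c<..<0} \<inter> space M)"
    by (intro measure_Un_le) auto
  also have "\<dots> \<le> prob (X -` {0<..} \<inter> space M) + prob (X -` {0} \<inter> space M) + prob (X -` {- c<..<0} \<inter> space M)"
    by (intro add_right_mono measure_Un_le) auto
  also have "\<dots> \<le> 1 / 2 + 0 + c / (2 * s)"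
    using half zero normal_prob_interval_le[OF X s, of "- c" 0] c by simp
  also have "c / (2 * s) \<le> 1 / 4"
    using c s by (simp add: divide_simps)
  finally show ?thesis by simp
qed

end


section \<open>Small sets of Brownian paths\<close>

lemma wiener_space: "wiener_measure W \<Longrightarrow> space W = paths"
  unfolding wiener_measure_def using sets_eq_imp_space_eq by blast

lemma wiener_measurable_eval:
  assumes "wiener_measure W" "0 \<le> t" shows "(\<lambda>B. B t) \<in> borel_measurable W"
proof -
  have "(\<lambda>B. B t) \<in> borel_measurable path_space"
    unfolding path_space_def using assms(2)
    by (intro measurable_restrict_space1 measurable_component_singleton) simp
  then show ?thesis
    using assms(1) unfolding wiener_measure_def by (simp cong: measurable_cong_sets)
qed

lemma wiener_increment:
  assumes W: "wiener_measure W" and "0 \<le> s" "s < t" and \<sigma>: "\<bar>\<sigma>\<bar> = 1"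
  shows "distributed W lborel (\<lambda>B. \<sigma> * (B t - B s)) (normal_density 0 (sqrt (t - s)))"
proof -
  interpret prob_space W using W by (simp add: wiener_measure_def)
  have "distributed W lborel (\<lambda>B. B t - B s) (normal_density 0 (sqrt (t - s)))"
    using assms unfolding wiener_measure_def by blast
  from normal_density_affine[OF this, of \<sigma> 0] show ?thesis
    using assms by auto
qed

lemma wiener_indep_increments:
  assumes W: "wiener_measure W" and \<tau>: "0 \<le> \<tau> 0" "strict_mono \<tau>"
  shows "prob_space.indep_vars W (\<lambda>_. borel) (\<lambda>i B. \<sigma> * (B (\<tau> (Suc i)) - B (\<tau> i))) {..<n::nat}"
proof -
  interpret prob_space W using W by (simp add: wiener_measure_def)
  have "indep_vars (\<lambda>_. borel) (\<lambda>i B. B (\<tau> (Suc i)) - B (\<tau> i)) {..<n}"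
    using W \<tau> unfolding wiener_measure_def by blast
  then show ?thesis
    by (rule indep_vars_compose2[where Y = "\<lambda>_ x. \<sigma> * x"]) simp
qed

lemma wiener_grid_min_small:
  fixes N :: nat
  assumes W: "wiener_measure W" and ab: "0 < a" "a < b" and \<sigma>: "\<bar>\<sigma>\<bar> = 1" and "0 < \<epsilon>"
  defines "g \<equiv> \<lambda>i. a + real i * ((b - a) / real (Suc N))"
  shows "measure W {B \<in> space W. (\<forall>i\<le>N. - \<epsilon> < \<sigma> * B (g i)) \<and> (\<exists>i\<le>N. \<sigma> * B (g i) < \<epsilon>)} \<le> \<epsilon> / sqrt a"
proof -
  interpret prob_space W using W by (simp add: wiener_measure_def)
  note [measurable] = wiener_measurable_eval[OF W]
  \<comment> \<open>Time 0 is put before the grid: \<open>X 0\<close> becomes the increment up to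
    \<open>a\<close>, and the later \<open>X i\<close> are the increments between grid
    points.\<close>
  define \<tau> where "\<tau> i = (case i of 0 \<Rightarrow> 0 | Suc j \<Rightarrow> g j)" for i
  have mono: "strict_mono \<tau>"
    unfolding strict_mono_Suc_iff using ab by (auto simp: \<tau>_def g_def divide_simps split: nat.split)
  have nonneg: "0 \<le> \<tau> i" for i
    using strict_mono_less_eq[OF mono, of 0 i] by (simp add: \<tau>_def)
  define X where "X i B = \<sigma> * (B (\<tau> (Suc i)) - B (\<tau> i))" for i B
  have ind: "indep_vars (\<lambda>_. borel) X {..<Suc N}"
    unfolding X_def using wiener_indep_increments[OF W _ mono] nonneg by blast
  \<comment> \<open>The minimum of the walk relative to its value at \<open>a\<close>;
    \<open>i = 0\<close> contributes the empty sum. It reads only the coordinates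
    \<open>1..N\<close>, hence is independent of \<open>X 0\<close>.\<close>
  define m :: "(nat \<Rightarrow> real) \<Rightarrow> real" where "m x = Min ((\<lambda>i. \<Sum>l\<in>{1..i}. x l) ` {..N})" for x
  have m_measurable: "m \<in> borel_measurable (Pi\<^sub>M {1..N} (\<lambda>_. borel))"
    unfolding m_def by (intro borel_measurable_Min borel_measurable_sum measurable_component_singleton) auto
  have "indep_var (Pi\<^sub>M {0} (\<lambda>_. borel)) (\<lambda>B. restrict (\<lambda>i. X i B) {0})
      (Pi\<^sub>M {1..N} (\<lambda>_. borel)) (\<lambda>B. restrict (\<lambda>i. X i B) {1..N})"
    by (rule indep_var_restrict[OF ind]) auto
  then have "indep_var borel ((\<lambda>x. x 0) \<circ> (\<lambda>B. restrict (\<lambda>i. X i B) {0}))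
      borel (m \<circ> (\<lambda>B. restrict (\<lambda>i. X i B) {1..N}))"
    by (rule indep_var_compose) (rule measurable_component_singleton, simp, rule m_measurable)
  moreover have "m (restrict x {1..N}) = m x" for x
    unfolding m_def by (intro arg_cong[where f = Min] image_cong refl sum.cong) auto
  ultimately have XY: "indep_var borel (X 0) borel (\<lambda>B. m (\<lambda>i. X i B))"
    by (simp add: o_def)
  have X0: "distributed W lborel (X 0) (normal_density 0 (sqrt a))"
    using wiener_increment[OF W _ _ \<sigma>, of 0 a] ab by (simp add: X_def[abs_def] \<tau>_def g_def)
  have rv: "random_variable borel (X 0)" "random_variable borel (\<lambda>B. m (\<lambda>i. X i B))"
    using XY by (auto dest: indep_var_rv1 indep_var_rv2)
  have walk: "\<sigma> * B (g i) = \<sigma> * B 0 + X 0 B + (\<Sum>l\<in>{1..i}. X l B)" for i B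
  proof (induction i)
    case (Suc i)
    have "\<sigma> * B (g (Suc i)) = \<sigma> * B (g i) + X (Suc i) B"
      by (simp add: X_def \<tau>_def right_diff_distrib)
    then show ?case using Suc by simp
  qed (simp add: X_def \<tau>_def right_diff_distrib)
  have "prob {B \<in> space W. (\<forall>i\<le>N. - \<epsilon> < \<sigma> * B (g i)) \<and> (\<exists>i\<le>N. \<sigma> * B (g i) < \<epsilon>)}
      \<le> prob {B \<in> space W. \<bar>X 0 B + m (\<lambda>i. X i B)\<bar> < \<epsilon>}"
  proof (rule finite_measure_mono_AE)
    show "{B \<in> space W. \<bar>X 0 B + m (\<lambda>i. X i B)\<bar> < \<epsilon>} \<in> sets W"
      using rv by measurable
    have "AE B in W. B 0 = 0" using W by (simp add: wiener_measure_def)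
    then show "AE B in W. B \<in> {B \<in> space W. (\<forall>i\<le>N. - \<epsilon> < \<sigma> * B (g i)) \<and> (\<exists>i\<le>N. \<sigma> * B (g i) < \<epsilon>)} \<longrightarrow>
        B \<in> {B \<in> space W. \<bar>X 0 B + m (\<lambda>i. X i B)\<bar> < \<epsilon>}"
    proof (eventually_elim, safe)
      fix B i assume B0: "B 0 = 0" and low: "\<forall>i\<le>N. - \<epsilon> < \<sigma> * B (g i)" and i: "i \<le> N" "\<sigma> * B (g i) < \<epsilon>"
      have "m (\<lambda>i. X i B) \<in> (\<lambda>i. \<Sum>l\<in>{1..i}. X l B) ` {..N}"
        unfolding m_def by (rule Min_in) auto
      then obtain k where k: "k \<le> N" "m (\<lambda>i. X i B) = (\<Sum>l\<in>{1..k}. X l B)" by auto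
      have "m (\<lambda>i. X i B) \<le> (\<Sum>l\<in>{1..i}. X l B)"
        unfolding m_def using i by (intro Min_le) auto
      then have "X 0 B + m (\<lambda>i. X i B) < \<epsilon>" using walk[of B i] i B0 by simp
      moreover have "- \<epsilon> < \<sigma> * B (g k)" using low k by blast
      then have "- \<epsilon> < X 0 B + m (\<lambda>i. X i B)" using walk[of B k] k B0 by simp
      ultimately show "\<bar>X 0 B + m (\<lambda>i. X i B)\<bar> < \<epsilon>" by (simp add: abs_less_iff)
    qed
  qed
  also have "\<dots> \<le> \<epsilon> / sqrt a"
    using ab \<open>0 < \<epsilon>\<close> by (intro normal_anti_concentration X0 XY) auto
  finally show ?thesis .
qed

text \<open>By continuity a value below \<open>\<epsilon>\<close> persists near \<open>t\<close>,
  and every sufficiently fine grid has a point there. The event thus lies in all but finitely many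
  grid events, and the tail intersections \<open>A M\<close> increase to a set that contains it
  while each has small measure.\<close>

lemma wiener_min_small:
  assumes W: "wiener_measure W" and ab: "0 < a" "a < b" and \<sigma>: "\<bar>\<sigma>\<bar> = 1" and \<epsilon>: "0 < \<epsilon>"
  shows "measure W {B \<in> paths. (\<forall>t\<in>{a..b}. - \<epsilon> < \<sigma> * B t) \<and> (\<exists>t\<in>{a<..<b}. \<sigma> * B t < \<epsilon>)} \<le> \<epsilon> / sqrt a"
    (is "measure W ?V \<le> _")
\<comment> \<open>This split replaces a measurability proof: \<open>measure\<close> is 0 on sets
  outside \<open>sets W\<close>.\<close>
proof (cases "?V \<in> sets W")
  case True
  interpret prob_space W using W by (simp add: wiener_measure_def)
  note [measurable] = wiener_measurable_eval[OF W]
  define g where "g N i = a + real i * ((b - a) / real (Suc N))" for N i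
  have g_ge: "a \<le> g N i" for N i using ab by (simp add: g_def)
  then have g_nonneg: "0 \<le> g N i" for N i using ab by (metis less_imp_le order_trans)
  define E where "E N = {B \<in> space W. (\<forall>i\<le>N. - \<epsilon> < \<sigma> * B (g N i)) \<and> (\<exists>i\<le>N. \<sigma> * B (g N i) < \<epsilon>)}" for N
  have E_sets [measurable]: "E N \<in> sets W" for N
    unfolding E_def using g_nonneg by measurable
  define A where "A M = (\<Inter>N\<in>{M..}. E N)" for M
  have A_sets: "A M \<in> sets W" for M
    unfolding A_def by (intro sets.countable_INT') auto
  have "prob (A M) \<le> \<epsilon> / sqrt a" for M
  proof -
    have "prob (A M) \<le> prob (E M)"
      by (rule finite_measure_mono) (auto simp: A_def)
    also have "\<dots> \<le> \<epsilon> / sqrt a"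
      unfolding E_def g_def by (rule wiener_grid_min_small[OF W ab \<sigma> \<epsilon>])
    finally show ?thesis .
  qed
  moreover have "(\<lambda>M. prob (A M)) \<longlonglongrightarrow> prob (\<Union>M. A M)"
    using A_sets by (intro finite_Lim_measure_incseq) (auto simp: incseq_def A_def)
  ultimately have "prob (\<Union>M. A M) \<le> \<epsilon> / sqrt a"
    by (intro LIMSEQ_le_const2) auto
  moreover have "?V \<subseteq> (\<Union>M. A M)"
  proof
    fix B assume "B \<in> ?V"
    then have B: "B \<in> paths" and low: "\<And>t. t \<in> {a..b} \<Longrightarrow> - \<epsilon> < \<sigma> * B t"
      and "\<exists>t\<in>{a<..<b}. \<sigma> * B t < \<epsilon>" by auto
    then obtain t where t: "a < t" "t < b" "\<sigma> * B t < \<epsilon>" by auto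
    have "continuous_on {0..} (\<lambda>t. \<sigma> * B t)"
      using B by (intro continuous_intros) (simp add: paths_eq)
    moreover have "\<epsilon> - \<sigma> * B t > 0" "t \<ge> 0" using t ab by auto
    ultimately obtain d where d: "d > 0" "\<And>s. s \<ge> 0 \<Longrightarrow> \<bar>s - t\<bar> < d \<Longrightarrow> \<bar>\<sigma> * B s - \<sigma> * B t\<bar> < \<epsilon> - \<sigma> * B t"
      unfolding continuous_on_iff dist_real_def by (metis atLeast_iff)
    have "(\<lambda>N. (b - a) / real (Suc N)) \<longlonglongrightarrow> 0"
      by (rule real_tendsto_divide_at_top[OF tendsto_const
          filterlim_compose[OF filterlim_real_sequentially filterlim_Suc]])
    then have "\<forall>\<^sub>F N in sequentially. (b - a) / real (Suc N) < d"
      using d(1) by (rule order_tendstoD)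
    then obtain M where M: "\<And>N. N \<ge> M \<Longrightarrow> (b - a) / real (Suc N) < d"
      unfolding eventually_sequentially by blast
    have "B \<in> E N" if "N \<ge> M" for N
    proof -
      define h where "h = (b - a) / real (Suc N)"
      have h: "0 < h" "h < d" "real (Suc N) * h = b - a" using ab M[OF that] by (auto simp: h_def)
      have g: "g N j = a + real j * h" for j by (simp add: g_def h_def)
      define i where "i = nat \<lfloor>(t - a) / h\<rfloor>"
      have "0 \<le> (t - a) / h" using t h by simp
      then have i: "real i \<le> (t - a) / h" "(t - a) / h < real i + 1" unfolding i_def by linarith+
      then have gi: "g N i \<le> t" "t < g N i + h"
        using h by (simp_all add: g field_simps)
      have "(t - a) / h < real (Suc N)" using h t by (simp add: pos_divide_less_eq)
      then have "i \<le> N" using i by linarith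
      moreover have "\<sigma> * B (g N i) < \<epsilon>"
        using d(2)[OF g_nonneg[of N i]] gi h by auto
      moreover have "- \<epsilon> < \<sigma> * B (g N j)" if "j \<le> N" for j
      proof (rule low)
        have "real j * h \<le> real (Suc N) * h" using that h by (intro mult_right_mono) auto
        then show "g N j \<in> {a..b}" using h(1) unfolding g h(3) by simp
      qed
      ultimately show ?thesis using B wiener_space[OF W] unfolding E_def by blast
    qed
    then show "B \<in> (\<Union>M. A M)" by (auto simp: A_def)
  qed
  ultimately show ?thesis
    using A_sets by (meson finite_measure_mono order_trans sets.countable_UN' countableI_type image_subset_iff)
next
  case False
  then show ?thesis using \<epsilon> ab by (simp add: measure_notin_sets)
qed

text \<open>At the times \<open>\<tau> i\<close>, running from \<open>b / r ^ N\<close> to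
  \<open>b\<close>, suppose \<open>\<sigma> * B (\<tau> i) \<le> K * sqrt (\<tau> i)\<close> and the
  next increment is at most \<open>- ((K + 1) * sqrt (\<tau> i))\<close>. Then the next value is at
  most \<open>- sqrt (\<tau> i) \<le> - \<delta>\<close>. Staying above \<open>- \<delta>\<close>
  thus forces some large value (\<open>G i\<close>, at most \<open>1 / K^2\<close> each) or no large
  drop at all (\<open>H\<close>). By the choice of \<open>r\<close> a drop is at most half a
  standard deviation of its increment, so independence bounds \<open>H\<close> by
  \<open>(3/4) ^ N\<close>.\<close>

lemma wiener_persistence:
  assumes W: "wiener_measure W" and b: "0 < b" and \<sigma>: "\<bar>\<sigma>\<bar> = 1" and K: "0 < K"
    and r: "1 < r" "2 * (K + 1) \<le> sqrt (r - 1)" and \<delta>: "0 < \<delta>" "\<delta> \<le> sqrt (b / r ^ N)"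
    and V: "V \<subseteq> {B \<in> paths. \<forall>t\<in>{0..b}. - \<delta> < \<sigma> * B t}"
  shows "measure W V \<le> real N / K\<^sup>2 + (3/4) ^ N"
proof (cases "V \<in> sets W")
  case True
  interpret prob_space W using W by (simp add: wiener_measure_def)
  note [measurable] = wiener_measurable_eval[OF W]
  define \<tau> where "\<tau> i = b / r ^ N * r ^ i" for i
  have pos: "0 < \<tau> i" for i using b r by (simp add: \<tau>_def)
  have Suc: "\<tau> (Suc i) - \<tau> i = \<tau> i * (r - 1)" for i by (simp add: \<tau>_def algebra_simps diff_divide_distrib)
  then have "\<tau> i < \<tau> (Suc i)" for i using pos[of i] r by (metis diff_gt_0_iff_gt mult_pos_pos)
  then have mono: "strict_mono \<tau>" by (simp add: strict_mono_Suc_iff)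
  have \<tau>N: "\<tau> N = b" using r by (simp add: \<tau>_def)
  define X where "X i B = \<sigma> * (B (\<tau> (Suc i)) - B (\<tau> i))" for i B
  define G where "G i = {B \<in> space W. K * sqrt (\<tau> i) < \<sigma> * B (\<tau> i)}" for i
  \<comment> \<open>The outer \<open>space W\<close> matters for \<open>N = 0\<close>, where the
    empty intersection would be \<open>UNIV\<close>.\<close>
  define H where "H = space W \<inter> (\<Inter>i\<in>{..<N}. X i -` {- ((K + 1) * sqrt (\<tau> i))<..} \<inter> space W)"
  have [measurable]: "G i \<in> sets W" for i
    unfolding G_def using less_imp_le[OF pos[of i]] by measurable
  have X_measurable [measurable]: "X i \<in> borel_measurable W" for i
    unfolding X_def using less_imp_le[OF pos[of i]] less_imp_le[OF pos[of "Suc i"]] by measurable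
  have [measurable]: "H \<in> sets W" unfolding H_def by measurable
  have G: "prob (G i) \<le> 1 / K\<^sup>2" for i
  proof -
    have "prob (G i) = prob {B \<in> space W. K * sqrt (\<tau> i) < \<sigma> * (B (\<tau> i) - B 0)}"
    proof (rule finite_measure_eq_AE)
      show "{B \<in> space W. K * sqrt (\<tau> i) < \<sigma> * (B (\<tau> i) - B 0)} \<in> sets W"
        using less_imp_le[OF pos[of i]] by measurable
      have "AE B in W. B 0 = 0" using W by (simp add: wiener_measure_def)
      then show "AE B in W. (B \<in> G i) = (B \<in> {B \<in> space W. K * sqrt (\<tau> i) < \<sigma> * (B (\<tau> i) - B 0)})"
        by eventually_elim (simp add: G_def)
    qed simp
    also have "\<dots> \<le> 1 / K\<^sup>2"
      using wiener_increment[OF W _ pos[of i] \<sigma>] pos[of i] K by (intro normal_tail_le) auto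
    finally show ?thesis .
  qed
  have H: "prob H \<le> (3/4) ^ N"
  proof (cases "N = 0")
    case False
    have ind: "indep_vars (\<lambda>_. borel) X {..<N}"
      unfolding X_def using wiener_indep_increments[OF W _ mono] pos[of 0] by (simp add: less_imp_le)
    have "H = (\<Inter>i\<in>{..<N}. X i -` {- ((K + 1) * sqrt (\<tau> i))<..} \<inter> space W)"
      using False by (auto simp: H_def)
    then have "prob H = (\<Prod>i<N. prob (X i -` {- ((K + 1) * sqrt (\<tau> i))<..} \<inter> space W))"
      using indep_varsD_finite[OF ind, of "\<lambda>i. {- ((K + 1) * sqrt (\<tau> i))<..}"] False by auto
    also have "\<dots> \<le> (\<Prod>i<N. 3 / 4)"
    proof (intro prod_mono conjI measure_nonneg)
      fix i
      have "distributed W lborel (X i) (normal_density 0 (sqrt (\<tau> i * (r - 1))))"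
        using wiener_increment[OF W _ _ \<sigma>, of "\<tau> i" "\<tau> (Suc i)"] pos[of i] Suc[of i]
          strict_monoD[OF mono, of i "Suc i"] by (simp add: X_def[abs_def] less_imp_le)
      moreover have "2 * ((K + 1) * sqrt (\<tau> i)) \<le> sqrt (\<tau> i * (r - 1))"
        using r(2) pos[of i] by (simp add: real_sqrt_mult mult.commute mult_left_mono flip: mult.assoc)
      ultimately show "prob (X i -` {- ((K + 1) * sqrt (\<tau> i))<..} \<inter> space W) \<le> 3 / 4"
        using pos[of i] r K by (intro normal_greater_le) (auto simp: less_imp_le)
    qed
    also have "\<dots> = (3/4) ^ N" by simp
    finally show ?thesis .
  qed simp
  have "V \<subseteq> (\<Union>i<N. G i) \<union> H"
  proof
    fix B assume "B \<in> V"
    then have B: "B \<in> space W" and low: "\<And>t. 0 \<le> t \<Longrightarrow> t \<le> b \<Longrightarrow> - \<delta> < \<sigma> * B t"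
      using V wiener_space[OF W] by auto
    show "B \<in> (\<Union>i<N. G i) \<union> H"
    proof (rule ccontr)
      assume neg: "B \<notin> (\<Union>i<N. G i) \<union> H"
      then obtain i where i: "i < N" "X i B \<le> - ((K + 1) * sqrt (\<tau> i))"
        using B unfolding H_def Un_iff Int_iff INT_iff vimage_eq by (auto simp: not_less)
      have "\<sigma> * B (\<tau> i) \<le> K * sqrt (\<tau> i)" using neg B i by (auto simp: G_def not_less)
      moreover have "- \<delta> < \<sigma> * B (\<tau> (Suc i))"
      proof (rule low)
        show "\<tau> (Suc i) \<le> b" using strict_mono_less_eq[OF mono, of "Suc i" N] i by (simp add: \<tau>N)
      qed (use pos[of "Suc i"] in simp)
      moreover have "\<delta> \<le> sqrt (\<tau> i)"
      proof -
        have "\<tau> 0 \<le> \<tau> i" using strict_mono_less_eq[OF mono, of 0 i] by simp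
        then show ?thesis using \<delta>(2) by (simp add: \<tau>_def) (metis order_trans real_sqrt_le_iff)
      qed
      ultimately show False
        using i(2) by (simp add: X_def algebra_simps)
    qed
  qed
  then have "prob V \<le> prob ((\<Union>i<N. G i) \<union> H)"
    by (intro finite_measure_mono) auto
  also have "\<dots> \<le> prob (\<Union>i<N. G i) + prob H"
    by (intro measure_Un_le) auto
  also have "prob (\<Union>i<N. G i) \<le> (\<Sum>i<N. prob (G i))"
    by (intro finite_measure_subadditive_finite) auto
  also have "(\<Sum>i<N. prob (G i)) \<le> (\<Sum>i<N. 1 / K\<^sup>2)"
    by (intro sum_mono G)
  finally show ?thesis using H by simp
next
  case False
  then show ?thesis using K by (simp add: measure_notin_sets)
qed


section \<open>Martin-Loef tests\<close>

text \<open>The enumerated codes are those for which some witness \<open>w\<close> passes a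
  decidable check; in the uses below, \<open>w\<close> packs a precision and a grid size.\<close>

lemma effectively_open_certificate:
  assumes dec: "decidable 3 (\<lambda>\<phi> xs. Q (xs ! 1) (xs ! 2) (xs ! 0))"
    and sound: "\<And>n k w. Q n k w \<Longrightarrow> basic_open k \<subseteq> V n"
    and complete: "\<And>n B. B \<in> V n \<Longrightarrow> \<exists>k w. Q n k w \<and> B \<in> basic_open k"
  shows "effectively_open V"
  unfolding effectively_open_def
proof (intro exI conjI allI)
  show "ce_rel (\<lambda>n k. \<exists>w. Q n k w)" by (rule ce_rel_ex[OF dec])
  show "V n = (\<Union>k\<in>{k. \<exists>w. Q n k w}. basic_open k)" for n
  proof (intro equalityI subsetI)
    show "B \<in> (\<Union>k\<in>{k. \<exists>w. Q n k w}. basic_open k)" if "B \<in> V n" for B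
      using complete[OF that] by auto
    show "B \<in> V n" if "B \<in> (\<Union>k\<in>{k. \<exists>w. Q n k w}. basic_open k)" for B
      using that by (auto dest: sound)
  qed
qed

section \<open>Basic open sets as approximations of their members\<close>

definition centre :: "nat \<Rightarrow> nat \<Rightarrow> nat" where
  "centre k i = fst (prod_decode (code_nth k i))"

definition radii_le :: "nat \<Rightarrow> nat \<Rightarrow> bool" where
  "radii_le k s \<longleftrightarrow> (\<forall>i<length (list_decode k). rat_code (snd (prod_decode (code_nth k i))) \<le> (1/2) ^ s)"

text \<open>Supplies the hypothesis of the certificate lemmas for all paths in a basic open set at
  once, so that one check of its centres covers the whole set.\<close>

lemma basic_open_approximates:
  assumes "B \<in> basic_open k" "radii_le k s"
  shows "B \<in> paths" "approximates (centre k) B (length (list_decode k)) ((1/2) ^ s)"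
proof -
  show "B \<in> paths" using assms by (simp add: basic_open_def)
  show "approximates (centre k) B (length (list_decode k)) ((1/2) ^ s)"
    unfolding approximates_def
  proof (intro allI impI)
    fix i assume i: "i < length (list_decode k)"
    then have "uniform_dist (piece B i) (polygon_code (centre k i)) < rat_code (snd (prod_decode (code_nth k i)))"
      using assms(1) by (simp add: basic_open_def list_decode_nth centre_def split_beta)
    also have "\<dots> \<le> (1/2) ^ s" using assms(2) i by (simp add: radii_le_def)
    finally show "uniform_dist (piece B i) (polygon_code (centre k i)) \<le> (1/2) ^ s" by simp
  qed
qed

lemma ex_basic_open:
  assumes B: "B \<in> paths"
  obtains k where "B \<in> basic_open k" "radii_le k s" "length (list_decode k) = L"
proof -
  obtain \<phi> where \<phi>: "path_name \<phi> B" using ex_path_name[OF B] .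
  have "(1/2::real) ^ s \<in> \<rat>" by simp
  then obtain r where r: "rat_code r = (1/2) ^ s" by (rule rat_code_surj)
  \<comment> \<open>Centres of precision \<open>Suc s\<close> inside balls of radius
    \<open>(1/2) ^ s\<close> give the strict inequality that an open ball demands.\<close>
  define k where "k = list_encode (map (\<lambda>i. prod_encode (\<phi> (prod_encode (i, Suc s)), r)) [0..<L])"
  have len: "length (list_decode k) = L" by (simp add: k_def)
  have nth: "list_decode k ! i = prod_encode (\<phi> (prod_encode (i, Suc s)), r)" if "i < L" for i
    using that by (simp add: k_def)
  have "uniform_dist (piece B i) (polygon_code (\<phi> (prod_encode (i, Suc s)))) < rat_code r" for i
  proof -
    have "uniform_dist (piece B i) (polygon_code (\<phi> (prod_encode (i, Suc s)))) \<le> (1/2) ^ Suc s"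
      using \<phi> unfolding path_name_def by blast
    also have "\<dots> < (1/2) ^ s" by simp
    finally show ?thesis by (simp add: r)
  qed
  then have "B \<in> basic_open k" using B by (simp add: basic_open_def len nth)
  moreover have "radii_le k s"
    using r len nth list_decode_nth[of _ k] by (auto simp: radii_le_def)
  ultimately show ?thesis using len by (rule that)
qed

lemma eventually_half_power_less: "0 < c \<Longrightarrow> \<forall>\<^sub>F s in sequentially. C * (1/2) ^ s < (c::real)"
proof -
  assume "0 < c"
  have "(\<lambda>s. C * (1/2::real) ^ s) \<longlonglongrightarrow> C * 0"
    by (intro tendsto_mult tendsto_const LIMSEQ_power_zero) simp
  then show ?thesis using order_tendstoD(2)[of _ "C * 0" sequentially c] \<open>0 < c\<close> by simp
qed

lemma ex_lower_margin:
  assumes B: "B \<in> paths" and ab: "0 \<le> a" "a \<le> b" and lower: "\<And>t. t \<in> {a..b} \<Longrightarrow> \<theta> < \<sigma> * B t"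
  obtains \<gamma> where "0 < \<gamma>" "\<And>t. t \<in> {a..b} \<Longrightarrow> \<theta> + \<gamma> \<le> \<sigma> * B t"
proof -
  have "continuous_on {a..b} (\<lambda>t. \<sigma> * B t)"
    by (intro continuous_intros continuous_on_subset[OF paths_continuous[OF B]]) (use ab in auto)
  from continuous_attains_inf[OF _ _ this] ab obtain u where
    u: "u \<in> {a..b}" "\<And>t. t \<in> {a..b} \<Longrightarrow> \<sigma> * B u \<le> \<sigma> * B t" by auto
  show ?thesis
    by (rule that[of "\<sigma> * B u - \<theta>"]) (use u lower in auto)
qed

text \<open>The order of quantifiers matters: \<open>s\<close> is chosen before \<open>c\<close>,
  but \<open>N\<close> may depend on \<open>c\<close>, whose slope bound is not controlled by the
  precision. Half of the compactness margin pays for the approximation error, half for the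
  grid.\<close>

lemma eventually_lower_cert:
  assumes B: "B \<in> paths" and \<sigma>: "\<bar>\<sigma>\<bar> = 1" and ab: "0 \<le> a" "a \<le> b"
    and lower: "\<And>t. t \<in> {a..b} \<Longrightarrow> \<theta> < \<sigma> * B t"
  shows "\<forall>\<^sub>F s in sequentially. \<forall>c. approximates c B L ((1/2) ^ s) \<longrightarrow>
    (\<forall>\<^sub>F N in sequentially. lower_cert c L N a b (\<theta> + real L * (1/2) ^ s) \<sigma>)"
proof -
  obtain \<gamma> where \<gamma>: "0 < \<gamma>" "\<And>t. t \<in> {a..b} \<Longrightarrow> \<theta> + \<gamma> \<le> \<sigma> * B t"
    using ex_lower_margin[OF B ab lower] by blast
  have "\<forall>\<^sub>F s in sequentially. (2 * real L) * (1/2) ^ s < \<gamma> / 2"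
    using \<gamma> by (intro eventually_half_power_less) simp
  then show ?thesis
  proof eventually_elim
    case (elim s)
    show ?case
    proof (intro allI impI)
      fix c assume c: "approximates c B L ((1/2) ^ s)"
      show "\<forall>\<^sub>F N in sequentially. lower_cert c L N a b (\<theta> + real L * (1/2) ^ s) \<sigma>"
      proof (rule lower_cert_complete[OF B c \<sigma> ab])
        show "\<theta> + 2 * real L * (1/2) ^ s + \<gamma> / 2 \<le> \<sigma> * B t" if "t \<in> {a..b}" for t
          using \<gamma>(2)[OF that] elim by linarith
      qed (use \<gamma> in simp)
    qed
  qed
qed

lemma eventually_point_cert:
  assumes B: "B \<in> paths" and \<sigma>: "\<bar>\<sigma>\<bar> = 1"
    and t: "0 \<le> t" "t \<in> {a<..<b}" "t < real L" and upper: "\<sigma> * B t < \<theta>"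
  shows "\<forall>\<^sub>F s in sequentially. \<forall>c. approximates c B L ((1/2) ^ s) \<longrightarrow>
    (\<forall>\<^sub>F N in sequentially. point_cert c L N a b (\<theta> - real L * (1/2) ^ s) \<sigma>)"
proof -
  have "\<forall>\<^sub>F s in sequentially. (2 * real L) * (1/2) ^ s < \<theta> - \<sigma> * B t"
    using upper by (intro eventually_half_power_less) simp
  then show ?thesis
    by eventually_elim (auto intro!: point_cert_complete[OF B _ \<sigma> t])
qed

lemma computable_centre [computable_intros]:
  "computable n f \<Longrightarrow> computable n g \<Longrightarrow> computable n (\<lambda>\<phi> xs. centre (f \<phi> xs) (g \<phi> xs))"
  unfolding centre_def by (intro computable_intros)

lemma decidable_radii_le [computable_intros]:
  assumes "computable n f" "computable n g"
  shows "decidable n (\<lambda>\<phi> xs. radii_le (f \<phi> xs) (g \<phi> xs))"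
  unfolding radii_le_def by (intro computable_intros assms)

text \<open>A nonzero start is a lower bound for \<open>B\<close> or \<open>- B\<close> on the
  degenerate interval from 0 to 0, so the same certificate applies.\<close>

lemma effectively_open_start_nonzero:
  "effectively_open (\<lambda>_. {B \<in> paths. B 0 \<noteq> 0})"
proof (rule effectively_open_certificate)
  let ?L = "\<lambda>k. length (list_decode k)"
  let ?cert = "\<lambda>s N k. lower_cert (centre k) (?L k) N 0 0 (real (?L k) * (1/2) ^ s)"
  \<comment> \<open>\<open>0 < ?L k\<close> excludes the empty list of constraints, for which the
    certificate holds vacuously although the basic open set contains all paths.\<close>
  define Q where "Q n k w = (let s = fst (prod_decode w); N = snd (prod_decode w) in
    0 < ?L k \<and> radii_le k s \<and> (?cert s N k 1 \<or> ?cert s N k (-1)))" for n k w :: nat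
  show "decidable 3 (\<lambda>\<phi> xs. Q (xs ! 1) (xs ! 2) (xs ! 0))"
    unfolding Q_def Let_def by (intro computable_intros) simp_all
  show "basic_open k \<subseteq> {B \<in> paths. B 0 \<noteq> 0}" if Q: "Q n k w" for n k w
  proof
    fix B assume B: "B \<in> basic_open k"
    obtain s N \<sigma> where *: "0 < ?L k" "radii_le k s" "?cert s N k \<sigma>" and \<sigma>: "\<bar>\<sigma>\<bar> = 1"
      using Q unfolding Q_def Let_def by (elim conjE disjE) (auto intro: that)
    note appr = basic_open_approximates[OF B *(2)]
    have "real (?L k) * (1/2) ^ s - real (?L k) * (1/2) ^ s < \<sigma> * B 0"
      by (rule lower_cert_sound[OF appr *(3) \<sigma>]) (use *(1) in auto)
    then show "B \<in> {B \<in> paths. B 0 \<noteq> 0}" using appr by auto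
  qed
  show "\<exists>k w. Q n k w \<and> B \<in> basic_open k" if BV: "B \<in> {B \<in> paths. B 0 \<noteq> 0}" for n B
  proof -
    have B: "B \<in> paths" using BV by simp
    obtain \<sigma> where \<sigma>: "\<sigma> = 1 \<or> \<sigma> = -1" "0 < \<sigma> * B 0"
    proof (cases "0 < B 0")
      case True then show ?thesis by (intro that[of 1]) auto
    next
      case False then show ?thesis using BV by (intro that[of "-1"]) auto
    qed
    have "\<forall>\<^sub>F s in sequentially. \<forall>c. approximates c B 1 ((1/2) ^ s) \<longrightarrow>
        (\<forall>\<^sub>F N in sequentially. lower_cert c 1 N 0 0 (0 + real 1 * (1/2) ^ s) \<sigma>)"
      by (rule eventually_lower_cert[OF B]) (use \<sigma> in auto)
    then obtain s where s: "\<And>c. approximates c B 1 ((1/2) ^ s) \<Longrightarrow>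
        \<forall>\<^sub>F N in sequentially. lower_cert c 1 N 0 0 (0 + real 1 * (1/2) ^ s) \<sigma>"
      using eventually_happens'[OF sequentially_bot] by blast
    obtain k where k: "B \<in> basic_open k" "radii_le k s" "?L k = 1"
      using ex_basic_open[OF B] .
    have "\<forall>\<^sub>F N in sequentially. lower_cert (centre k) 1 N 0 0 (0 + real 1 * (1/2) ^ s) \<sigma>"
      using basic_open_approximates(2)[OF k(1,2)] k(3) by (intro s) simp
    then obtain N where "lower_cert (centre k) 1 N 0 0 (0 + real 1 * (1/2) ^ s) \<sigma>"
      using eventually_happens'[OF sequentially_bot] by blast
    then have "Q n k (prod_encode (s, N))"
      using \<sigma> k by (auto simp: Q_def)
    then show ?thesis using k by blast
  qed
qed

text \<open>The lower bound on the closed interval and the small interior value are each confirmed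
  by a finite certificate. Both thresholds are shifted by \<open>L * (1/2) ^ s\<close>, exactly what
  soundness loses.\<close>

lemma effectively_open_min_small:
  assumes ab: "0 \<le> rat_code a" "rat_code a < rat_code b" and \<sigma>: "\<sigma> = 1 \<or> \<sigma> = -1"
    and e: "computable 1 (\<lambda>\<phi> xs. e (xs ! 0))"
  shows "effectively_open (\<lambda>n. {B \<in> paths. (\<forall>t\<in>{rat_code a..rat_code b}. - ((1/2) ^ e n) < \<sigma> * B t) \<and>
    (\<exists>t\<in>{rat_code a<..<rat_code b}. \<sigma> * B t < (1/2) ^ e n)})"
    (is "effectively_open ?V")
proof (rule effectively_open_certificate)
  let ?L = "\<lambda>k. length (list_decode k)"
  let ?a = "rat_code a" and ?b = "rat_code b"
  have \<sigma>1: "\<bar>\<sigma>\<bar> = 1" and \<sigma>_rat: "\<sigma> \<in> \<rat>" using \<sigma> by auto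
  define Q where "Q n k w = (let s = fst (prod_decode w); N = snd (prod_decode w) in
    ?b < real (?L k) \<and> radii_le k s \<and>
    lower_cert (centre k) (?L k) N ?a ?b (real (?L k) * (1/2) ^ s - (1/2) ^ e n) \<sigma> \<and>
    point_cert (centre k) (?L k) N ?a ?b ((1/2) ^ e n - real (?L k) * (1/2) ^ s) \<sigma>)" for n k w :: nat
  show "decidable 3 (\<lambda>\<phi> xs. Q (xs ! 1) (xs ! 2) (xs ! 0))"
    unfolding Q_def Let_def by (intro computable_intros \<sigma>_rat computable_comp1[OF e]) simp_all
  show "basic_open k \<subseteq> ?V n" if Q: "Q n k w" for n k w
  proof
    fix B assume B: "B \<in> basic_open k"
    define s where "s = fst (prod_decode w)"
    define N where "N = snd (prod_decode w)"
    have *: "?b < real (?L k)" "radii_le k s"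
      "lower_cert (centre k) (?L k) N ?a ?b (real (?L k) * (1/2) ^ s - (1/2) ^ e n) \<sigma>"
      "point_cert (centre k) (?L k) N ?a ?b ((1/2) ^ e n - real (?L k) * (1/2) ^ s) \<sigma>"
      using Q by (simp_all add: Q_def Let_def s_def N_def)
    note appr = basic_open_approximates[OF B *(2)]
    have "- ((1/2) ^ e n) < \<sigma> * B t" if "t \<in> {?a..?b}" for t
      using lower_cert_sound[OF appr *(3) \<sigma>1 ab(1) *(1) that] by simp
    moreover obtain t where "t \<in> {?a<..<?b}" "\<sigma> * B t < (1/2) ^ e n"
      using point_cert_sound[OF appr *(4) \<sigma>1] by auto
    ultimately show "B \<in> ?V n" using appr(1) by blast
  qed
  show "\<exists>k w. Q n k w \<and> B \<in> basic_open k" if BV: "B \<in> ?V n" for n B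
  proof -
    have B: "B \<in> paths" and low: "\<And>t. t \<in> {?a..?b} \<Longrightarrow> - ((1/2) ^ e n) < \<sigma> * B t"
      using BV by auto
    obtain t where t: "t \<in> {?a<..<?b}" "\<sigma> * B t < (1/2) ^ e n" using BV by blast
    obtain L :: nat where L: "?b < real L" using reals_Archimedean2 by blast
    have "\<forall>\<^sub>F s in sequentially. \<forall>c. approximates c B L ((1/2) ^ s) \<longrightarrow>
        (\<forall>\<^sub>F N in sequentially. lower_cert c L N ?a ?b (- ((1/2) ^ e n) + real L * (1/2) ^ s) \<sigma>)"
      by (rule eventually_lower_cert[OF B \<sigma>1]) (use ab low in auto)
    moreover have "\<forall>\<^sub>F s in sequentially. \<forall>c. approximates c B L ((1/2) ^ s) \<longrightarrow>
        (\<forall>\<^sub>F N in sequentially. point_cert c L N ?a ?b ((1/2) ^ e n - real L * (1/2) ^ s) \<sigma>)"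
      by (rule eventually_point_cert[OF B \<sigma>1 _ t(1) _ t(2)]) (use ab L t in auto)
    ultimately have "\<forall>\<^sub>F s in sequentially. \<forall>c. approximates c B L ((1/2) ^ s) \<longrightarrow>
        (\<forall>\<^sub>F N in sequentially. lower_cert c L N ?a ?b (- ((1/2) ^ e n) + real L * (1/2) ^ s) \<sigma> \<and>
          point_cert c L N ?a ?b ((1/2) ^ e n - real L * (1/2) ^ s) \<sigma>)"
      by eventually_elim (simp add: eventually_conj)
    then obtain s where s: "\<And>c. approximates c B L ((1/2) ^ s) \<Longrightarrow>
        \<forall>\<^sub>F N in sequentially. lower_cert c L N ?a ?b (- ((1/2) ^ e n) + real L * (1/2) ^ s) \<sigma> \<and>
          point_cert c L N ?a ?b ((1/2) ^ e n - real L * (1/2) ^ s) \<sigma>"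
      using eventually_happens'[OF sequentially_bot] by blast
    obtain k where k: "B \<in> basic_open k" "radii_le k s" "?L k = L"
      using ex_basic_open[OF B] .
    have "approximates (centre k) B L ((1/2) ^ s)"
      using basic_open_approximates(2)[OF k(1,2)] k(3) by simp
    from s[OF this] obtain N where "lower_cert (centre k) L N ?a ?b (- ((1/2) ^ e n) + real L * (1/2) ^ s) \<sigma>"
      "point_cert (centre k) L N ?a ?b ((1/2) ^ e n - real L * (1/2) ^ s) \<sigma>"
      using eventually_happens'[OF sequentially_bot] by blast
    then have "Q n k (prod_encode (s, N))"
      using k L by (simp add: Q_def)
    then show ?thesis using k by blast
  qed
qed

text \<open>An effectively open null set, repeated at every level, is a test.\<close>

lemma martin_loef_test_start_nonzero:
  assumes W: "wiener_measure W"
  shows "martin_loef_test W (\<lambda>_. {B \<in> paths. B 0 \<noteq> 0})"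
proof -
  interpret prob_space W using W by (simp add: wiener_measure_def)
  have "AE B in W. B 0 = 0" using W by (simp add: wiener_measure_def)
  then have "AE B in W. \<not> B 0 \<noteq> 0" by simp
  then have "measure W {B \<in> paths. B 0 \<noteq> 0} = 0"
    unfolding wiener_space[OF W, symmetric] measure_def by (subst emeasure_eq_0_AE) auto
  then show ?thesis
    by (simp add: martin_loef_test_def effectively_open_start_nonzero)
qed

text \<open>
  The number \<open>C\<close> accounts for \<open>a\<close> and \<open>b\<close>. For \<open>a > 0\<close> it suffices that the other summand is at least \<open>n\<close>;
  for \<open>a = 0\<close> it makes the slack at most \<open>1 / r ^ N\<close>, where \<open>N = 3 n + 3\<close> times with ratio \<open>r = 2 ^ (2 n + 9)\<close>
  are observed.
\<close>

definition test_exponent :: "nat \<Rightarrow> nat \<Rightarrow> nat" where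
  "test_exponent C n = C + (2 * n + 9) * (3 * n + 3)"

lemma measure_min_small:
  assumes W: "wiener_measure W" and ab: "0 \<le> a" "a < b" and \<sigma>: "\<bar>\<sigma>\<bar> = 1"
    and C: "(1/2) ^ C \<le> sqrt b" "0 < a \<Longrightarrow> (1/2) ^ C \<le> sqrt a"
  shows "measure W {B \<in> paths. (\<forall>t\<in>{a..b}. - ((1/2) ^ test_exponent C n) < \<sigma> * B t) \<and>
    (\<exists>t\<in>{a<..<b}. \<sigma> * B t < (1/2) ^ test_exponent C n)} \<le> (1/2) ^ n"
    (is "measure W ?V \<le> _")
proof -
  interpret prob_space W using W by (simp add: wiener_measure_def)
  define \<epsilon> :: real where "\<epsilon> = (1/2) ^ test_exponent C n"
  have \<epsilon>: "0 < \<epsilon>" by (simp add: \<epsilon>_def)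
  show ?thesis
  proof (cases "a = 0")
    case False
    have "n \<le> (2 * n + 9) * (3 * n + 3)" by (simp add: algebra_simps)
    then have "\<epsilon> \<le> (1/2) ^ (C + n)"
      unfolding \<epsilon>_def test_exponent_def by (intro power_decreasing) auto
    also have "\<dots> \<le> sqrt a * (1/2) ^ n"
      using C(2) False ab by (simp add: power_add)
    finally have "\<epsilon> / sqrt a \<le> (1/2) ^ n"
      using False ab by (simp add: pos_divide_le_eq mult.commute)
    moreover have "measure W ?V \<le> \<epsilon> / sqrt a"
      using wiener_min_small[OF W _ ab(2) \<sigma> \<epsilon>] False ab unfolding \<epsilon>_def by simp
    ultimately show ?thesis by simp
  next
    case True
    \<comment> \<open>\<open>(3/4) ^ 3 \<le> 1/2\<close> gives
      \<open>(3/4) ^ N \<le> (1/2) ^ Suc n\<close>. \<open>K\<close> is at least \<open>N\<close>,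
      so \<open>N / K^2 \<le> 1 / K\<close>. Finally \<open>2 * (K + 1) \<le> 4 * K\<close>, and
      \<open>(4 * K)^2 = r / 2 \<le> r - 1\<close>.\<close>
    define N where "N = 3 * n + 3"
    define K :: real where "K = 2 ^ (n + 2)"
    define r :: real where "r = 2 ^ (2 * n + 9)"
    have b: "0 < b" using ab True by simp
    have "2 ^ 9 \<le> r" unfolding r_def by (intro power_increasing) auto
    then have r1: "1 < r" by simp
    have r: "2 * (K + 1) \<le> sqrt (r - 1)"
    proof (rule real_le_rsqrt)
      have "1 \<le> K" unfolding K_def by (rule one_le_power) simp
      then have "(2 * (K + 1))\<^sup>2 \<le> (4 * K)\<^sup>2" by (intro power_mono) auto
      also have "\<dots> = r / 2"
        by (simp add: K_def r_def power_mult_distrib power_add power_mult power2_eq_square flip: power_mult_distrib)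
      also have "\<dots> \<le> r - 1" using \<open>2 ^ 9 \<le> r\<close> by simp
      finally show "(2 * (K + 1))\<^sup>2 \<le> r - 1" .
    qed
    have \<delta>: "\<epsilon> \<le> sqrt (b / r ^ N)"
    proof -
      have "r ^ N = 2 ^ ((2 * n + 9) * (3 * n + 3))"
        unfolding r_def N_def by (rule power_mult[symmetric])
      then have "\<epsilon> = (1/2) ^ C * (1 / r ^ N)"
        unfolding \<epsilon>_def test_exponent_def power_add by (simp only: power_one_over)
      \<comment> \<open>Only \<open>1 / sqrt (r ^ N)\<close> is required; giving away the square
        root avoids halving the exponent.\<close>
      also have "1 / r ^ N \<le> 1 / sqrt (r ^ N)"
      proof -
        have "1 \<le> r ^ N" using r1 by simp
        then have "sqrt (r ^ N) \<le> r ^ N" by (intro real_le_lsqrt self_le_power) auto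
        then show ?thesis using \<open>1 \<le> r ^ N\<close> by (intro divide_left_mono) (auto simp: r1 intro!: mult_pos_pos)
      qed
      finally have "\<epsilon> \<le> (1/2) ^ C * (1 / sqrt (r ^ N))" by simp
      also have "\<dots> \<le> sqrt b * (1 / sqrt (r ^ N))"
        using C(1) r1 by (intro mult_right_mono) auto
      finally show ?thesis by (simp add: real_sqrt_divide)
    qed
    have "?V \<subseteq> {B \<in> paths. \<forall>t\<in>{0..b}. - \<epsilon> < \<sigma> * B t}"
      using True by (auto simp: \<epsilon>_def)
    then have "measure W ?V \<le> real N / K\<^sup>2 + (3/4) ^ N"
      by (intro wiener_persistence[OF W b \<sigma> _ r1 r \<epsilon> \<delta>]) (simp_all add: K_def)
    moreover have "real N / K\<^sup>2 \<le> (1/2) ^ Suc n"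
    proof -
      have "Suc n \<le> 2 ^ n" by (simp add: Suc_leI)
      moreover have "(2::nat) ^ (n + 2) = 4 * 2 ^ n" by simp
      ultimately have "N \<le> 2 ^ (n + 2)" unfolding N_def by linarith
      then have "real N \<le> K" unfolding K_def by (metis of_nat_le_iff of_nat_numeral of_nat_power)
      then have "real N / K\<^sup>2 \<le> K / K\<^sup>2" by (simp add: divide_right_mono)
      also have "\<dots> = (1/2) ^ (n + 2)" by (simp add: K_def power2_eq_square power_one_over)
      also have "\<dots> \<le> (1/2) ^ Suc n" by (intro power_decreasing) auto
      finally show ?thesis .
    qed
    moreover have "(3/4 :: real) ^ N \<le> (1/2) ^ Suc n"
    proof -
      have "(3/4 :: real) ^ N = ((3/4) ^ 3) ^ Suc n"
        unfolding N_def power_mult[symmetric] by (simp add: add.commute)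
      also have "\<dots> \<le> (1/2) ^ Suc n" by (intro power_mono) (simp_all add: power3_eq_cube)
      finally show ?thesis .
    qed
    ultimately show ?thesis using power_Suc[of "1/2::real" n] by linarith
  qed
qed


text \<open>\<open>C\<close> is obtained by comparing reals, without an algorithm in
  \<open>a\<close> and \<open>b\<close>. This is harmless: each interval gets its own test, and a
  random path escapes every test.\<close>

lemma martin_loef_test_min_small:
  assumes W: "wiener_measure W" and ab: "0 \<le> rat_code a" "rat_code a < rat_code b"
    and \<sigma>: "\<sigma> = 1 \<or> \<sigma> = -1"
  obtains C where "martin_loef_test W (\<lambda>n. {B \<in> paths.
    (\<forall>t\<in>{rat_code a..rat_code b}. - ((1/2) ^ test_exponent C n) < \<sigma> * B t) \<and>
    (\<exists>t\<in>{rat_code a<..<rat_code b}. \<sigma> * B t < (1/2) ^ test_exponent C n)})"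
proof -
  \<comment> \<open>For \<open>a = 0\<close> the default 1 keeps \<open>m\<close> positive, where
    \<open>sqrt 0\<close> would not.\<close>
  define m where "m = min (sqrt (rat_code b)) (if 0 < rat_code a then sqrt (rat_code a) else 1)"
  have "0 < m" using ab by (auto simp: m_def)
  then obtain C where "(1/2) ^ C < m" using real_arch_pow_inv[of m "1/2"] by auto
  then have C: "(1/2) ^ C \<le> sqrt (rat_code b)" "0 < rat_code a \<Longrightarrow> (1/2) ^ C \<le> sqrt (rat_code a)"
    by (auto simp: m_def)
  have "computable 1 (\<lambda>\<phi> xs. test_exponent C (xs ! 0))"
    unfolding test_exponent_def by (intro computable_intros) simp_all
  moreover have "\<bar>\<sigma>\<bar> = 1" using \<sigma> by auto
  ultimately show ?thesis
    by (intro that[of C])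
      (simp add: martin_loef_test_def effectively_open_min_small[OF ab \<sigma>] measure_min_small[OF W ab _ C])
qed


section \<open>Zeros of random paths\<close>

text \<open>Nonnegativity on the open interval extends to its closure, so a zero at \<open>t\<close>
  would make the minimum exactly 0. Since \<open>t\<close> may be an end, continuity also has to
  supply interior values below every \<open>\<epsilon>\<close>; then \<open>B\<close> lies in every
  level of the test.\<close>

lemma random_path_min_nonzero:
  assumes W: "wiener_measure W" and B: "martin_loef_random W B"
    and ab: "0 \<le> rat_code a" "rat_code a < rat_code b" and \<sigma>: "\<sigma> = 1 \<or> \<sigma> = -1"
    and nonneg: "\<And>t. t \<in> {rat_code a<..<rat_code b} \<Longrightarrow> 0 \<le> \<sigma> * B t"
    and t: "t \<in> {rat_code a..rat_code b}"
  shows "B t \<noteq> 0"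
proof
  assume "B t = 0"
  have paths: "B \<in> paths" using B by (simp add: martin_loef_random_def)
  have closure: "{rat_code a..rat_code b} = closure {rat_code a<..<rat_code b}"
    using ab by simp
  have cont: "continuous_on {rat_code a..rat_code b} (\<lambda>t. \<sigma> * B t)"
    by (intro continuous_intros continuous_on_subset[OF paths_continuous[OF paths]]) (use ab in auto)
  have ge: "0 \<le> \<sigma> * B u" if "u \<in> {rat_code a..rat_code b}" for u
    using continuous_ge_on_closure[OF cont[unfolded closure]] that nonneg unfolding closure by blast
  have small: "\<exists>u\<in>{rat_code a<..<rat_code b}. \<sigma> * B u < \<epsilon>" if "0 < \<epsilon>" for \<epsilon>
  proof (rule ccontr)
    assume "\<not> ?thesis"
    then have "\<epsilon> \<le> \<sigma> * B u" if "u \<in> {rat_code a<..<rat_code b}" for u using that by (auto simp: not_less)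
    then have "\<epsilon> \<le> \<sigma> * B t"
      using continuous_ge_on_closure[OF cont[unfolded closure]] t unfolding closure by blast
    with \<open>B t = 0\<close> that show False by simp
  qed
  obtain C where test: "martin_loef_test W (\<lambda>n. {B \<in> paths.
      (\<forall>t\<in>{rat_code a..rat_code b}. - ((1/2) ^ test_exponent C n) < \<sigma> * B t) \<and>
      (\<exists>t\<in>{rat_code a<..<rat_code b}. \<sigma> * B t < (1/2) ^ test_exponent C n)})" (is "martin_loef_test W ?V")
    using martin_loef_test_min_small[OF W ab \<sigma>] .
  have "B \<in> ?V n" for n
  proof -
    have "0 < (1/2::real) ^ test_exponent C n" by simp
    then have "- ((1/2) ^ test_exponent C n) < \<sigma> * B u" if "u \<in> {rat_code a..rat_code b}" for u
      using ge[OF that] by linarith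
    then show ?thesis using paths small[of "(1/2) ^ test_exponent C n"] by simp
  qed
  then show False using B test unfolding martin_loef_random_def by blast
qed

text \<open>Contraposition of the preceding lemma: \<open>\<sigma> = 1\<close> yields
  \<open>u\<close>, and \<open>\<sigma> = -1\<close> yields \<open>v\<close>.\<close>

lemma random_path_sign_change:
  assumes W: "wiener_measure W" and B: "martin_loef_random W B"
    and ab: "0 \<le> rat_code a" "rat_code a < rat_code b"
    and zero: "t \<in> {rat_code a..rat_code b}" "B t = 0"
  obtains u v where "u \<in> {rat_code a<..<rat_code b}" "v \<in> {rat_code a<..<rat_code b}" "B u < 0" "0 < B v"
proof -
  have "\<exists>u\<in>{rat_code a<..<rat_code b}. \<not> 0 \<le> \<sigma> * B u" if "\<sigma> = 1 \<or> \<sigma> = -1" for \<sigma>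
    using random_path_min_nonzero[OF W B ab that _ zero(1)] zero(2) by blast
  from this[of 1] this[of "-1"] show ?thesis by (auto simp: not_le intro: that)
qed

lemma random_path_start:
  assumes W: "wiener_measure W" and B: "martin_loef_random W B" shows "B 0 = 0"
  using B martin_loef_test_start_nonzero[OF W] by (auto simp: martin_loef_random_def)

lemma closed_zero_set:
  assumes "B \<in> paths" shows "closed (zero_set B)"
proof -
  have "zero_set B = {t \<in> {0..}. B t = 0}" by (auto simp: zero_set_def)
  then show ?thesis
    using continuous_closed_preimage_constant[OF paths_continuous[OF assms]] by simp
qed

lemma sign_change_zero:
  assumes B: "B \<in> paths" and "0 \<le> u" "0 \<le> v" "u \<in> {a<..<b}" "v \<in> {a<..<b}" "B u < 0" "0 < B v"
  shows "zero_set B \<inter> {a<..<b} \<noteq> {}"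
proof -
  \<comment> \<open>The left end \<open>a\<close> may be negative, and \<open>B\<close> is
    continuous only on \<open>{0..}\<close>, hence the intersection.\<close>
  have "connected (B ` ({0..} \<inter> {a<..<b}))"
    by (intro connected_continuous_image continuous_on_subset[OF paths_continuous[OF B]] convex_connected
        convex_Int convex_real_interval) auto
  moreover have "B u \<in> B ` ({0..} \<inter> {a<..<b})" "B v \<in> B ` ({0..} \<inter> {a<..<b})"
    using assms by auto
  ultimately have "0 \<in> B ` ({0..} \<inter> {a<..<b})"
    using assms connectedD_interval[of _ "B u" "B v" 0] by auto
  then show ?thesis by (auto simp: zero_set_def)
qed

text \<open>The threshold \<open>L * (1/2) ^ s\<close> is the error of the approximation, so a
  certificate fixes the sign of \<open>B\<close> itself. \<open>0 \<le> a\<close> and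
  \<open>b < L\<close> ensure that the cells cover \<open>[a, b]\<close>, as a universal claim
  requires; a sampled point of \<open>zero_cert\<close> is in range by itself.\<close>

definition no_zero_cert :: "(nat \<Rightarrow> nat) \<Rightarrow> real \<Rightarrow> real \<Rightarrow> nat \<Rightarrow> nat \<Rightarrow> nat \<Rightarrow> bool" where
  "no_zero_cert \<phi> a b s L N \<longleftrightarrow> 0 \<le> a \<and> b < real L \<and>
    (lower_cert (\<lambda>i. \<phi> (prod_encode (i, s))) L N a b (real L * (1/2) ^ s) 1 \<or>
     lower_cert (\<lambda>i. \<phi> (prod_encode (i, s))) L N a b (real L * (1/2) ^ s) (-1))"

definition zero_cert :: "(nat \<Rightarrow> nat) \<Rightarrow> real \<Rightarrow> real \<Rightarrow> nat \<Rightarrow> nat \<Rightarrow> nat \<Rightarrow> bool" where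
  "zero_cert \<phi> a b s L N \<longleftrightarrow> 
    point_cert (\<lambda>i. \<phi> (prod_encode (i, s))) L N a b (- (real L * (1/2) ^ s)) 1 \<and>
    point_cert (\<lambda>i. \<phi> (prod_encode (i, s))) L N a b (- (real L * (1/2) ^ s)) (-1)"

lemma no_zero_cert_sound:
  assumes B: "B \<in> paths" and \<phi>: "path_name \<phi> B" and cert: "no_zero_cert \<phi> a b s L N"
  shows "zero_set B \<inter> {a<..<b} = {}"
proof -
  from cert obtain \<sigma> where \<sigma>: "\<bar>\<sigma>\<bar> = 1" and ab: "0 \<le> a" "b < real L"
    and low: "lower_cert (\<lambda>i. \<phi> (prod_encode (i, s))) L N a b (real L * (1/2) ^ s) \<sigma>"
    unfolding no_zero_cert_def by (metis abs_minus abs_one)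
  have "B t \<noteq> 0" if "t \<in> {a..b}" for t
    using lower_cert_sound[OF B path_name_approximates[OF \<phi>] low \<sigma> ab that] by auto
  then show ?thesis by (auto simp: zero_set_def)
qed

lemma zero_cert_sound:
  assumes B: "B \<in> paths" and \<phi>: "path_name \<phi> B" and cert: "zero_cert \<phi> a b s L N"
  shows "zero_set B \<inter> {a<..<b} \<noteq> {}"
proof -
  have pt: "\<exists>t. t \<in> {a<..<b} \<and> 0 \<le> t \<and> \<sigma> * B t < 0" if "\<sigma> \<in> {1, -1}" for \<sigma>
  proof -
    have "\<bar>\<sigma>\<bar> = 1" using that by auto
    moreover have "point_cert (\<lambda>i. \<phi> (prod_encode (i, s))) L N a b (- (real L * (1/2) ^ s)) \<sigma>"
      using cert that by (auto simp: zero_cert_def)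
    ultimately obtain t where "t \<in> {a<..<b}" "0 \<le> t" "\<sigma> * B t < - (real L * (1/2) ^ s) + real L * (1/2) ^ s"
      using point_cert_sound[OF B path_name_approximates[OF \<phi>]] by blast
    then show ?thesis by auto
  qed
  obtain u where "u \<in> {a<..<b}" "0 \<le> u" "B u < 0" using pt[of 1] by auto
  moreover obtain v where "v \<in> {a<..<b}" "0 \<le> v" "0 < B v" using pt[of "-1"] by auto
  ultimately show ?thesis by (intro sign_change_zero[OF B])
qed

lemma no_zero_cert_complete:
  assumes B: "B \<in> paths" and \<phi>: "path_name \<phi> B" and ab: "0 \<le> a" "a < b"
    and nz: "\<And>t. t \<in> {a..b} \<Longrightarrow> B t \<noteq> 0"
  shows "\<exists>s L N. no_zero_cert \<phi> a b s L N"
proof -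
  obtain L :: nat where L: "b < real L" using reals_Archimedean2 by blast
  have "connected (B ` {a..b})"
    by (intro connected_continuous_image continuous_on_subset[OF paths_continuous[OF B]]) (use ab in auto)
  \<comment> \<open>By the intermediate value property, a path without zeros on
    \<open>[a, b]\<close> has constant sign there.\<close>
  then have "\<not> (B u \<le> 0 \<and> 0 \<le> B v)" if "u \<in> {a..b}" "v \<in> {a..b}" for u v
    using connectedD_interval[of "B ` {a..b}" "B u" "B v" 0] that nz by fastforce
  then have "(\<forall>t\<in>{a..b}. 0 < 1 * B t) \<or> (\<forall>t\<in>{a..b}. 0 < -1 * B t)"
    by (auto simp: not_le) (meson not_le less_imp_le)
  then obtain \<sigma> :: real where \<sigma>: "\<sigma> \<in> {1, -1}" "\<And>t. t \<in> {a..b} \<Longrightarrow> 0 < \<sigma> * B t"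
    by blast
  then have "\<bar>\<sigma>\<bar> = 1" by auto
  from eventually_lower_cert[OF B this ab(1) less_imp_le[OF ab(2)] \<sigma>(2), of L]
  obtain s where "\<And>c. approximates c B L ((1/2) ^ s) \<Longrightarrow>
      \<forall>\<^sub>F N in sequentially. lower_cert c L N a b (0 + real L * (1/2) ^ s) \<sigma>"
    using eventually_happens'[OF sequentially_bot] by blast
  from this[OF path_name_approximates[OF \<phi>]]
  obtain N where "lower_cert (\<lambda>i. \<phi> (prod_encode (i, s))) L N a b (0 + real L * (1/2) ^ s) \<sigma>"
    using eventually_happens'[OF sequentially_bot] by blast
  then have "no_zero_cert \<phi> a b s L N"
    using \<sigma>(1) ab L unfolding no_zero_cert_def by auto
  then show ?thesis by blast
qed

lemma zero_cert_complete:
  assumes B: "B \<in> paths" and \<phi>: "path_name \<phi> B" and a: "0 \<le> a"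
    and uv: "u \<in> {a<..<b}" "v \<in> {a<..<b}" "B u < 0" "0 < B v"
  shows "\<exists>s L N. zero_cert \<phi> a b s L N"
proof -
  obtain L :: nat where L: "b < real L" using reals_Archimedean2 by blast
  have pt: "\<forall>\<^sub>F s in sequentially. \<forall>c. approximates c B L ((1/2) ^ s) \<longrightarrow>
      (\<forall>\<^sub>F N in sequentially. point_cert c L N a b (0 - real L * (1/2) ^ s) \<sigma>)"
    if "t \<in> {a<..<b}" "\<sigma> * B t < 0" "\<bar>\<sigma>\<bar> = 1" for t \<sigma>
    by (rule eventually_point_cert[OF B that(3) _ that(1) _ that(2)]) (use a L that in auto)
  have "\<forall>\<^sub>F s in sequentially. \<forall>c. approximates c B L ((1/2) ^ s) \<longrightarrow>
      (\<forall>\<^sub>F N in sequentially. point_cert c L N a b (0 - real L * (1/2) ^ s) 1 \<and>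
        point_cert c L N a b (0 - real L * (1/2) ^ s) (-1))"
  proof -
    have "\<bar>1::real\<bar> = 1" "\<bar>-1::real\<bar> = 1" "1 * B u < 0" "-1 * B v < 0" using uv by auto
    from pt[OF uv(1) this(3,1)] pt[OF uv(2) this(4,2)] show ?thesis
      by eventually_elim (simp add: eventually_conj)
  qed
  then obtain s where "\<And>c. approximates c B L ((1/2) ^ s) \<Longrightarrow>
      \<forall>\<^sub>F N in sequentially. point_cert c L N a b (0 - real L * (1/2) ^ s) 1 \<and>
        point_cert c L N a b (0 - real L * (1/2) ^ s) (-1)"
    using eventually_happens'[OF sequentially_bot] by blast
  from this[OF path_name_approximates[OF \<phi>]]
  obtain N where "point_cert (\<lambda>i. \<phi> (prod_encode (i, s))) L N a b (0 - real L * (1/2) ^ s) 1 \<and>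
      point_cert (\<lambda>i. \<phi> (prod_encode (i, s))) L N a b (0 - real L * (1/2) ^ s) (-1)"
    using eventually_happens'[OF sequentially_bot] by blast
  then have "zero_cert \<phi> a b s L N" by (simp add: zero_cert_def)
  then show ?thesis by blast
qed

lemma decidable_certs [computable_intros]:
  assumes "computable n s" "computable n L" "computable n N" "computable_rat n a" "computable_rat n b"
  shows "decidable n (\<lambda>\<phi> xs. no_zero_cert \<phi> (a \<phi> xs) (b \<phi> xs) (s \<phi> xs) (L \<phi> xs) (N \<phi> xs))"
    and "decidable n (\<lambda>\<phi> xs. zero_cert \<phi> (a \<phi> xs) (b \<phi> xs) (s \<phi> xs) (L \<phi> xs) (N \<phi> xs))"
  unfolding no_zero_cert_def zero_cert_def by (intro computable_intros assms; simp)+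

theorem theorem3p6:
  fixes W :: "(real \<Rightarrow> real) measure" and U :: "nat \<Rightarrow> (real \<Rightarrow> real) set"
  assumes "wiener_measure W" and "universal_martin_loef_test W U"
  shows "(\<forall>B. martin_loef_random W B \<longrightarrow> zero_set B \<noteq> {} \<and> closed (zero_set B)) \<and>
    recursive_layerwise U zero_set"
proof (intro conjI allI impI)
  fix B assume B: "martin_loef_random W B"
  then show "closed (zero_set B)"
    by (intro closed_zero_set) (simp add: martin_loef_random_def)
  show "zero_set B \<noteq> {}"
    using random_path_start[OF assms(1) B] by (auto simp: zero_set_def)
next
  \<comment> \<open>One search number \<open>w\<close> packs the precision \<open>s\<close>, the
    number \<open>L\<close> of pieces and the grid size \<open>N\<close>.\<close>
  define pre where "pre cert \<phi> xs w = cert \<phi> (rat_code (xs ! 0)) (rat_code (xs ! 1)) (fst (prod_decode w))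
      (fst (prod_decode (snd (prod_decode w)))) (snd (prod_decode (snd (prod_decode w))))"
    for cert :: "(nat \<Rightarrow> nat) \<Rightarrow> real \<Rightarrow> real \<Rightarrow> nat \<Rightarrow> nat \<Rightarrow> nat \<Rightarrow> bool" and \<phi> xs w
  \<comment> \<open>The first two disjuncts end the search at once: no zero lies in
    \<open>(a, b)\<close> if \<open>b \<le> 0\<close>, and 0 does if \<open>a < 0 < b\<close>. As
    \<open>a < 0\<close> also holds for intervals left of 0, \<open>F\<close> tests
    \<open>b \<le> 0\<close> and ignores \<open>a < 0\<close>.\<close>
  define Q where "Q \<phi> xs w \<longleftrightarrow> rat_code (xs ! 1) \<le> 0 \<or> rat_code (xs ! 0) < 0 \<or>
      pre no_zero_cert \<phi> xs w \<or> pre zero_cert \<phi> xs w" for \<phi> xs w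
  define F :: "(nat \<Rightarrow> nat) \<Rightarrow> nat list \<Rightarrow> nat \<Rightarrow> nat"
    where "F \<phi> xs w = (if rat_code (xs ! 1) \<le> 0 \<or> pre no_zero_cert \<phi> xs w then 1 else 0)" for \<phi> xs w
  have "decidable (Suc 3) (\<lambda>\<phi> l. Q \<phi> (tl l) (hd l))"
    unfolding Q_def pre_def by (intro computable_intros) simp_all
  moreover have "computable (Suc 3) (\<lambda>\<phi> l. F \<phi> (tl l) (hd l))"
    unfolding F_def pre_def by (intro computable_intros) simp_all
  ultimately obtain p where p: "\<And>\<phi> xs y. length xs = 3 \<Longrightarrow> \<exists>w. Q \<phi> xs w \<Longrightarrow>
      (\<And>w. Q \<phi> xs w \<Longrightarrow> F \<phi> xs w = y) \<Longrightarrow> computes \<phi> p xs y"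
    by (rule computes_search) blast
  show "recursive_layerwise U zero_set"
    unfolding recursive_layerwise_def
  proof (rule exI[of _ p], intro allI ballI impI)
    fix n B \<phi> a b
    assume layer: "B \<in> layer U n" and \<phi>: "path_name \<phi> B" and ab: "rat_code a < rat_code b"
    have B: "martin_loef_random W B" and paths: "B \<in> paths"
      using layer assms(2) unfolding layer_def universal_martin_loef_test_def martin_loef_random_def by blast+
    let ?Z = "zero_set B \<inter> {rat_code a<..<rat_code b}"
    have Z0: "0 \<in> zero_set B" using random_path_start[OF assms(1) B] by (simp add: zero_set_def)
    have no_zero: "?Z = {}" if "pre no_zero_cert \<phi> [a, b, n] w" for w
      using no_zero_cert_sound[OF paths \<phi>] that by (simp add: pre_def)
    have zero: "?Z \<noteq> {}" if "pre zero_cert \<phi> [a, b, n] w" for w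
      using zero_cert_sound[OF paths \<phi>] that by (simp add: pre_def)
    show "computes \<phi> p [a, b, n] (if ?Z = {} then 1 else 0)"
    proof (rule p)
      show "\<exists>w. Q \<phi> [a, b, n] w"
      proof (cases "0 \<le> rat_code a")
        case True
        have pre: "pre cert \<phi> [a, b, n] (prod_encode (s, prod_encode (L, N))) =
            cert \<phi> (rat_code a) (rat_code b) s L N" for cert s L N
          by (simp add: pre_def)
        have "(\<exists>s L N. no_zero_cert \<phi> (rat_code a) (rat_code b) s L N) \<or>
            (\<exists>s L N. zero_cert \<phi> (rat_code a) (rat_code b) s L N)"
        proof (cases "\<forall>t\<in>{rat_code a..rat_code b}. B t \<noteq> 0")
          case nz: True
          then show ?thesis using no_zero_cert_complete[OF paths \<phi> True ab] by blast
        next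
          case False
          then obtain t where "t \<in> {rat_code a..rat_code b}" "B t = 0" by blast
          then show ?thesis
            using random_path_sign_change[OF assms(1) B True ab] zero_cert_complete[OF paths \<phi> True] by metis
        qed
        then show ?thesis unfolding Q_def pre[symmetric] by blast
      qed (simp add: Q_def)
      fix w assume "Q \<phi> [a, b, n] w"
      then have "rat_code b \<le> 0 \<or> rat_code a < 0 \<or> pre no_zero_cert \<phi> [a, b, n] w \<or> pre zero_cert \<phi> [a, b, n] w"
        by (simp add: Q_def)
      \<comment> \<open>In the last case the interval contains the zero 0, or a sign change has been
        certified.\<close>
      then consider "rat_code b \<le> 0" | "pre no_zero_cert \<phi> [a, b, n] w"
        | "0 < rat_code b" "\<not> pre no_zero_cert \<phi> [a, b, n] w" "rat_code a < 0 \<or> pre zero_cert \<phi> [a, b, n] w"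
        by (meson not_le)
      then show "F \<phi> [a, b, n] w = (if ?Z = {} then 1 else 0)"
      proof cases
        case 1
        then have "?Z = {}" by (auto simp: zero_set_def)
        then show ?thesis using 1 by (simp add: F_def)
      next
        case 2
        then show ?thesis using no_zero by (simp add: F_def)
      next
        case 3
        then have "?Z \<noteq> {}" using zero Z0 by auto
        then show ?thesis using 3 by (simp add: F_def)
      qed
    qed simp
  qed
qed

end
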